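(* Let $I=[0,1]$. There is a closed set $B \subseteq I \times I$ such that all cross-sections $B_x = \{y \in I : (x,y) \in B\}$ ($x\in I$) are uncountable, but there do not exist uncountably many pairwise disjoint Borel uniformizations of $B$ whose ranks (as Borel functions from $I$ to $I$) are bounded below $\omega_1$. That is, there do not exist an ordinal $\alpha<\omega_1$ and an uncountable family of pairwise disjoint Borel uniformizations of $B$ each of which has Borel function rank at most $\alpha$.
   Context: A Borel uniformization of $B \subseteq I\times I$ is a Borel set $U \subseteq B$ such that for every $x\in I$ there is a unique $y$ with $(x,y)\in U$. Equivalently, it is (the graph of) a Borel function $u\colon I\to I$ with $u(x)\in B_x$ for all $x\in I$. Two uniformizations are disjoint if they are disjoint as subsets of $I\times I$, i.e. the corresponding functions $u,u'$ satisfy $u(x)\neq u'(x)$ for all $x\in I$. A Borel function $u\colon I\to I$ has (Borel function) rank at most $\alpha$, where $1\le\alpha<\omega_1$, if $u^{-1}(O)$ is a $\boldsymbol{\Sigma}^0_\alpha$ set for every open $O\subseteq I$. The statement is a theorem of ZFC (no assumption on the size of the continuum). *)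

theory Defs
  imports "HOL-Analysis.Analysis"
begin

text \<open>
  A countable ordinal is represented by a well-order \<open>\<alpha> :: nat rel\<close> on a set of
  natural numbers, its field; every ordinal below the first uncountable one
  arises in this way. Such well-orders are compared by \<^const>\<open>ordLess\<close>, the
  strict order on order types, and none of the notions below distinguishes
  isomorphic well-orders. The empty relation represents 0.
\<close>

definition countable_ordinal :: "nat rel \<Rightarrow> bool" where
  "countable_ordinal \<alpha> \<longleftrightarrow> Well_order \<alpha>"

text \<open>
  \<open>Sigma0 X \<alpha> S\<close> says that \<open>S\<close> is a boldface \<open>\<Sigma>\<^sup>0\<^sub>\<alpha>\<close> subset of \<open>X\<close>, for countable
  \<open>\<alpha> \<ge> 1\<close>: the \<open>\<Sigma>\<^sup>0\<^sub>1\<close> sets are the open ones, and for \<open>\<alpha> \<ge> 2\<close> the \<open>\<Sigma>\<^sup>0\<^sub>\<alpha>\<close> sets are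
  the countable unions of sets \<open>A n\<close> whose complements are \<open>\<Sigma>\<^sup>0\<close> of levels
  \<open>\<beta> n\<close> with \<open>1 \<le> \<beta> n < \<alpha>\<close>. No set is at level 0, so the second rule
  applies only if \<open>\<alpha> \<ge> 2\<close>.
\<close>

inductive Sigma0 :: "'a topology \<Rightarrow> nat rel \<Rightarrow> 'a set \<Rightarrow> bool" for X :: "'a topology" where
  open_level:
    "Sigma0 X \<alpha> S" if "countable_ordinal \<alpha>" "card (Field \<alpha>) = 1" "openin X S"
| union_level:
    "Sigma0 X \<alpha> (\<Union>n. A n)"
      if "countable_ordinal \<alpha>"
        and "\<And>n::nat. (\<beta> n, \<alpha>) \<in> ordLess \<and> A n \<subseteq> topspace X \<and> Sigma0 X (\<beta> n) (topspace X - A n)"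

definition borel_rank_le ::
    "'a topology \<Rightarrow> 'b topology \<Rightarrow> ('a \<Rightarrow> 'b) \<Rightarrow> nat rel \<Rightarrow> bool" where
  "borel_rank_le X Y u \<alpha> \<longleftrightarrow>
     u \<in> topspace X \<rightarrow> topspace Y \<and>
     (\<forall>V. openin Y V \<longrightarrow> Sigma0 X \<alpha> {x \<in> topspace X. u x \<in> V})"

abbreviation I01 :: "real set" where
  "I01 \<equiv> {0..1}"

text \<open>
  As \<open>I01 \<times> I01\<close> is closed in the plane, its Borel subsets are exactly the Borel
  subsets of the plane contained in it.
\<close>

definition borel_uniformization :: "(real \<times> real) set \<Rightarrow> (real \<times> real) set \<Rightarrow> bool" where
  "borel_uniformization B U \<longleftrightarrow>
     U \<in> sets borel \<and> U \<subseteq> B \<and> (\<forall>x\<in>I01. \<exists>!y. (x, y) \<in> U)"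

definition graph_fun :: "('a \<times> 'b) set \<Rightarrow> 'a \<Rightarrow> 'b" where
  "graph_fun U x = (THE y. (x, y) \<in> U)"

end

theory Submission imports Defs begin

text \<open>
  A point \<open>x\<close> codes two trees on \<open>\<nat>\<close>, and a point of the section at \<open>x\<close> codes an embedding of one
  of them into the other; the codes form a closed subset of the Baire space, so that compactifying adds only
  countably many further points, the same ones for all \<open>x\<close>. Of any two trees one embeds into the
  other, but the choice cannot be made by a function of bounded rank that avoids the added points:
  take the two trees generic for Steel forcing with tagged trees, both of infinite rank, and
  let \<open>p\<close> force that tree \<open>b\<close> is embedded into the other. Replacing the infinite tags of the other
  tree by large ordinals does not affect what \<open>p\<close> forces at a bounded level of the Borel hierarchy,
  but now an ill-founded tree is embedded into a well-founded one.

  Hence for every uniformization \<open>u\<close> of rank at most \<open>\<alpha>\<close> some condition forces \<open>u\<close> to take a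
  fixed one of the added values. There are countably many pairs of a condition and an added point,
  so in an uncountable family two uniformizations share such a pair, and they agree at every
  sufficiently generic point below that condition.
\<close>

subsection \<open>Expansions in powers of a fixed base\<close>

text \<open>Over an infinite index type, base \<open>1/2\<close> is binary expansion and reaches all
  of \<open>I01\<close>, while base \<open>1/3\<close> lands in a Cantor set and is injective. The
  first will code pairs of trees, the second embeddings.\<close>

definition cval :: "real \<Rightarrow> ('a::countable \<Rightarrow> bool) \<Rightarrow> real" where
  "cval c T = (\<Sum>n. of_bool (T (from_nat_into UNIV n)) * c ^ Suc n)"

lemma summable_power_Suc: "0 < c \<Longrightarrow> c < 1 \<Longrightarrow> summable (\<lambda>n. (c::real) ^ Suc n)"
  by (subst summable_Suc_iff) (simp add: summable_geometric)

lemma suminf_power_Suc: "0 < c \<Longrightarrow> c < 1 \<Longrightarrow> (\<Sum>n. (c::real) ^ Suc n) = c / (1 - c)"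
  using suminf_mult[of "\<lambda>n. c ^ n" c] by (simp add: summable_geometric suminf_geometric)

lemma summable_cval:
  assumes "0 < c" "c < 1"
  shows "summable (\<lambda>n. of_bool (T (from_nat_into UNIV n)) * (c::real) ^ Suc n)"
  by (rule summable_comparison_test'[OF summable_power_Suc[OF assms], of 0])
     (use assms in \<open>auto simp: of_bool_def\<close>)

lemma cval_bounds:
  assumes "0 < c" "c \<le> 1/2"
  shows "cval c T \<in> I01"
proof -
  have c: "0 < c" "c < 1" using assms by auto
  have "cval c T \<le> (\<Sum>n. c ^ Suc n)"
    unfolding cval_def using c
    by (intro suminf_le summable_cval summable_power_Suc) (auto simp: of_bool_def)
  also have "\<dots> = c / (1 - c)" using suminf_power_Suc[OF c] .
  also have "\<dots> \<le> 1" using assms by (simp add: field_simps)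
  finally show ?thesis
    unfolding cval_def using c by (auto simp del: power_Suc intro!: suminf_nonneg summable_cval)
qed

lemma continuous_on_of_bool_coordinate:
  "continuous_on UNIV (\<lambda>T. of_bool (T n) :: real)"
  using continuous_on_compose2[of UNIV "of_bool :: bool \<Rightarrow> real" UNIV "\<lambda>T. T n"]
  by simp

lemma continuous_on_cval:
  assumes "0 < c" "c < 1"
  shows "continuous_on UNIV (cval c :: ('a::countable \<Rightarrow> bool) \<Rightarrow> real)"
proof -
  let ?f = "\<lambda>n (T :: 'a \<Rightarrow> bool). of_bool (T (from_nat_into UNIV n)) * c ^ Suc n :: real"
  have "uniform_limit UNIV (\<lambda>n T. \<Sum>i<n. ?f i T) (\<lambda>T. \<Sum>i. ?f i T) sequentially"
    using assms by (intro Weierstrass_m_test[OF _ summable_power_Suc[OF assms]]) (auto simp: of_bool_def)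
  moreover have "\<forall>\<^sub>F n in sequentially. continuous_on UNIV (\<lambda>T. \<Sum>i<n. ?f i T)"
    by (intro always_eventually allI continuous_intros continuous_on_of_bool_coordinate)
  ultimately have "continuous_on UNIV (\<lambda>T. \<Sum>i. ?f i T)"
    by (intro uniform_limit_theorem[where F = sequentially]) simp_all
  then show ?thesis unfolding cval_def[abs_def] by simp
qed

lemma bij_enum:
  assumes "infinite (UNIV :: 'a::countable set)"
  shows "bij (from_nat_into (UNIV :: 'a set))"
  using bij_betw_from_nat_into[of "UNIV :: 'a set"] assms by simp

text \<open>Two expansions with the same value split at the first difference \<open>n\<close> into one that
  continues with zeros only and one that continues with ones only, and this needs \<open>c = 1/2\<close>.\<close>

lemma cval_eq_first_difference:
  fixes T T' :: "'a::countable \<Rightarrow> bool"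
  defines "e \<equiv> from_nat_into (UNIV :: 'a set)"
  assumes c: "0 < c" "c \<le> 1/2" and eq: "cval c T = cval c T'"
    and n: "T (e n)" "\<not> T' (e n)" and agree: "\<And>m. m < n \<Longrightarrow> T (e m) = T' (e m)"
  shows "c = 1/2 \<and> (\<forall>m>n. \<not> T (e m) \<and> T' (e m))"
proof -
  have c1: "c < 1" using c by simp
  have sm: "summable (\<lambda>n. of_bool (T (e n)) * c ^ Suc n)" for T :: "'a \<Rightarrow> bool"
    unfolding e_def by (rule summable_cval[OF c(1) c1])
  define d where "d m = (of_bool (T (e m)) - of_bool (T' (e m))) * c ^ Suc m" for m
  have d_eq: "d = (\<lambda>m. of_bool (T (e m)) * c ^ Suc m - of_bool (T' (e m)) * c ^ Suc m)"
    by (auto simp: d_def algebra_simps)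
  have smd: "summable d" unfolding d_eq by (intro summable_diff sm)
  have "suminf d = 0"
    unfolding d_eq using eq suminf_diff[OF sm[of T] sm[of T']] by (simp add: cval_def e_def)
  moreover have "(\<Sum>i<Suc n. d i) = c ^ Suc n"
    using agree n by (simp add: d_def)
  ultimately have tail: "(\<Sum>m. d (m + Suc n)) = - (c ^ Suc n)"
    using suminf_split_initial_segment[OF smd, of "Suc n"] by simp
  \<comment> \<open>Adding a full geometric tail makes every term nonnegative, as the digits of
    \<open>d\<close> are at least -1. The total is nonnegative only if \<open>c = 1/2\<close>; then
    it is 0 and every term vanishes.\<close>
  define g where "g m = c ^ Suc m * c ^ Suc n + d (m + Suc n)" for m
  have g_eq: "g m = c ^ Suc (m + Suc n) * (1 + of_bool (T (e (m + Suc n))) - of_bool (T' (e (m + Suc n))))" for m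
    by (simp add: g_def d_def power_add algebra_simps)
  have g0: "0 \<le> g m" for m unfolding g_eq using c by (intro mult_nonneg_nonneg) (auto simp: of_bool_def)
  have smt: "summable (\<lambda>m. d (m + Suc n))" using smd by (rule summable_ignore_initial_segment)
  have smc: "summable (\<lambda>m. c ^ Suc m * c ^ Suc n)"
    using summable_power_Suc[OF c(1) c1] by (rule summable_mult2)
  have smg: "summable g" unfolding g_def using smt smc by (intro summable_add)
  have "suminf g = c / (1 - c) * c ^ Suc n - c ^ Suc n"
    unfolding g_def using suminf_add[OF smc smt] tail
      suminf_mult2[OF summable_power_Suc[OF c(1) c1], of "c ^ Suc n"] suminf_power_Suc[OF c(1) c1]
    by simp
  also have "\<dots> = (2 * c - 1) / (1 - c) * c ^ Suc n" using c1 by (simp add: field_simps)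
  finally have sg: "suminf g = (2 * c - 1) / (1 - c) * c ^ Suc n" .
  have "0 \<le> suminf g" using smg g0 by (intro suminf_nonneg)
  moreover have "0 < c ^ Suc n" using c by simp
  ultimately have "0 \<le> (2 * c - 1) / (1 - c)" unfolding sg by (simp only: zero_le_mult_iff) linarith
  then have "c = 1/2" using c c1 by (simp add: zero_le_divide_iff)
  with sg have "\<forall>m. g m = 0" using suminf_eq_zero_iff[OF smg g0] by simp
  then have *: "T' (e (m + Suc n)) \<and> \<not> T (e (m + Suc n))" for m
    using c unfolding g_eq by (auto simp: of_bool_def split: if_splits dest!: spec[of _ m])
  have "T' (e m) \<and> \<not> T (e m)" if "m > n" for m using *[of "m - Suc n"] that by simp
  then show ?thesis using \<open>c = 1/2\<close> by blast
qed

lemma first_difference: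
  fixes T T' :: "'a::countable \<Rightarrow> bool"
  assumes "infinite (UNIV :: 'a set)" "T \<noteq> T'"
  obtains n where "T (from_nat_into UNIV n) \<noteq> T' (from_nat_into UNIV n)"
    "\<And>m. m < n \<Longrightarrow> T (from_nat_into UNIV m) = T' (from_nat_into UNIV m)"
proof -
  let ?e = "from_nat_into (UNIV :: 'a set)"
  obtain x where "T x \<noteq> T' x" using assms by auto
  moreover obtain n0 where "?e n0 = x" using bij_enum[OF assms(1)] by (metis bij_pointE)
  ultimately have ex: "\<exists>n. T (?e n) \<noteq> T' (?e n)" by blast
  show thesis
    by (rule that[of "LEAST n. T (?e n) \<noteq> T' (?e n)"]) (use LeastI_ex[OF ex] not_less_Least in blast)+
qed

lemma cval_inject:
  fixes T T' :: "'a::countable \<Rightarrow> bool"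
  assumes "infinite (UNIV :: 'a set)" "0 < c" "c < 1/2" "cval c T = cval c T'"
  shows "T = T'"
proof (rule ccontr)
  assume "T \<noteq> T'"
  then obtain n where n: "T (from_nat_into UNIV n) \<noteq> T' (from_nat_into UNIV n)"
    "\<And>m. m < n \<Longrightarrow> T (from_nat_into UNIV m) = T' (from_nat_into UNIV m)"
    using first_difference[OF assms(1)] by blast
  have c: "c \<le> 1/2" using assms by simp
  have "c = 1/2"
  proof (cases "T (from_nat_into UNIV n)")
    case True
    then show ?thesis using cval_eq_first_difference[OF assms(2) c assms(4), of n] n by blast
  next
    case False
    then show ?thesis using cval_eq_first_difference[OF assms(2) c assms(4)[symmetric], of n] n by blast
  qed
  with assms(3) show False by simp
qed

text \<open>In base 2 only expansions ending in constant 0 or constant 1 are ambiguous, and an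
  infinite, co-infinite set has no such expansion.\<close>

lemma cval_half_unique:
  fixes T T' :: "'a::countable \<Rightarrow> bool"
  assumes inf: "infinite (UNIV :: 'a set)" and eq: "cval (1/2) T = cval (1/2) T'"
    and T: "infinite {x. T x}" "infinite {x. \<not> T x}"
  shows "T' = T"
proof (rule ccontr)
  let ?e = "from_nat_into (UNIV :: 'a set)"
  have fin: "finite {x. Q x}" if "\<And>m. m > n \<Longrightarrow> \<not> Q (?e m)" for Q n
  proof -
    have "{x. Q x} \<subseteq> ?e ` {..n}"
      using that bij_enum[OF inf] by (smt (verit) atMost_iff bij_pointE image_eqI mem_Collect_eq not_less subsetI)
    then show ?thesis by (rule finite_subset) simp
  qed
  assume "T' \<noteq> T"
  then obtain n where n: "T (?e n) \<noteq> T' (?e n)" "\<And>m. m < n \<Longrightarrow> T (?e m) = T' (?e m)"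
    using first_difference[OF inf, of T T'] by blast
  show False
  proof (cases "T (?e n)")
    case True
    then show ?thesis using cval_eq_first_difference[OF _ _ eq, of n] n T(1) fin[of n T] by simp
  next
    case False
    then show ?thesis
      using cval_eq_first_difference[OF _ _ eq[symmetric], of n] n T(2) fin[of n "\<lambda>x. \<not> T x"] by simp
  qed
qed

lemma cval_half_surj:
  assumes inf: "infinite (UNIV :: 'a::countable set)" and x: "x \<in> I01"
  obtains T :: "'a::countable \<Rightarrow> bool" where "cval (1/2) T = x"
proof (cases "x = 1")
  case True
  have "cval (1/2) (\<lambda>_::'a. True) = 1"
    using suminf_power_Suc[of "1/2"] by (simp add: cval_def)
  with True that show ?thesis by blast
next
  case False
  with x have x: "0 \<le> x" "x < 1" by auto
  let ?e = "from_nat_into (UNIV :: 'a set)"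
  \<comment> \<open>The integer spelled by the first \<open>n\<close> binary digits of
    \<open>x\<close>; its parity is the last of them.\<close>
  define a where "a n = \<lfloor>2 ^ n * x\<rfloor>" for n :: nat
  define T where "T y \<longleftrightarrow> odd (a (Suc (inv ?e y)))" for y
  have Te: "T (?e n) \<longleftrightarrow> odd (a (Suc n))" for n
    unfolding T_def using bij_enum[OF inf] by (simp add: bij_is_inj)
  have step: "a (Suc n) = 2 * a n + of_bool (odd (a (Suc n)))" for n
  proof -
    have "a (Suc n) = 2 * a n \<or> a (Suc n) = 2 * a n + 1"
      unfolding a_def by (simp add: mult.assoc) linarith
    then show ?thesis by auto
  qed
  have part: "(\<Sum>i<n. of_bool (T (?e i)) * (1/2) ^ Suc i) = real_of_int (a n) / 2 ^ n" for n
  proof (induction n)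
    case 0
    have "\<lfloor>x\<rfloor> = 0" using x by linarith
    then show ?case by (simp add: a_def)
  next
    case (Suc n)
    have "real_of_int (a (Suc n)) = 2 * of_int (a n) + of_bool (odd (a (Suc n)))"
      by (subst step) simp
    then show ?case using Suc by (simp add: Te field_simps)
  qed
  have "(\<lambda>n. real_of_int (a n) / 2 ^ n) \<longlonglongrightarrow> x"
  proof (rule tendsto_sandwich)
    have a: "real_of_int (a n) \<le> 2 ^ n * x" "2 ^ n * x - 1 \<le> real_of_int (a n)" for n
      unfolding a_def by linarith+
    have "x - (1/2) ^ n = (2 ^ n * x - 1) / 2 ^ n" for n
      by (simp add: diff_divide_distrib power_one_over)
    then show "\<forall>\<^sub>F n in sequentially. x - (1/2) ^ n \<le> real_of_int (a n) / 2 ^ n"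
      using a(2) by (intro always_eventually allI) (simp add: divide_right_mono)
    show "\<forall>\<^sub>F n in sequentially. real_of_int (a n) / 2 ^ n \<le> x"
      using a(1) by (intro always_eventually allI) (simp add: pos_divide_le_eq algebra_simps)
    have "(\<lambda>n. x - (1/2) ^ n) \<longlonglongrightarrow> x - 0" by (intro tendsto_intros) auto
    then show "(\<lambda>n. x - (1/2) ^ n) \<longlonglongrightarrow> x" by simp
  qed simp
  then have "(\<lambda>i. of_bool (T (?e i)) * (1/2) ^ Suc i) sums x"
    unfolding sums_def part .
  then have "cval (1/2) T = x" unfolding cval_def by (rule sums_unique[symmetric])
  with that show ?thesis by blast
qed

section \<open>Open sets and compactness in spaces of predicates\<close>

lemma open_fun_agree_finite:
  fixes A :: "('a \<Rightarrow> bool) set"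
  assumes "open A" "T \<in> A"
  obtains F where "finite F" "\<And>T'. (\<And>n. n \<in> F \<Longrightarrow> T' n = T n) \<Longrightarrow> T' \<in> A"
proof -
  have "openin (product_topology (\<lambda>i. euclidean) UNIV) A" using assms by (simp add: open_fun_def)
  from product_topology_open_contains_basis[OF this assms(2)] obtain X where
    X: "T \<in> (\<Pi>\<^sub>E i\<in>UNIV. X i)" "finite {i. X i \<noteq> UNIV}" "(\<Pi>\<^sub>E i\<in>UNIV. X i) \<subseteq> A"
    by auto
  show thesis
  proof (rule that[OF X(2)])
    fix T' assume *: "\<And>n. n \<in> {i. X i \<noteq> UNIV} \<Longrightarrow> T' n = T n"
    have "T' i \<in> X i" for i using * X(1) by (cases "X i = UNIV") (auto simp: PiE_UNIV_domain)
    then show "T' \<in> A" using X(3) by (auto simp: PiE_UNIV_domain)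
  qed
qed

lemma compact_UNIV_fun_bool: "compact (UNIV :: ('a \<Rightarrow> bool) set)"
proof -
  have "compact_space (product_topology (\<lambda>i::'a. euclidean :: bool topology) UNIV)"
    unfolding compact_space_product_topology by (auto simp: compact_space_def finite_imp_compact)
  then show ?thesis by (simp add: euclidean_product_topology compact_space_def)
qed

subsection \<open>Tagged trees\<close>

text \<open>A tag of a node of a tree: \<open>Out\<close> for a node outside the tree, \<open>Low a k\<close> for the ordinal
  \<open>\<omega> \<cdot> a + k\<close>, \<open>Top k\<close> for \<open>\<omega> \<cdot> r + k\<close>, where \<open>r\<close> is the ambient well-order, and
  \<open>Infin\<close> for a node of infinite rank.\<close>

datatype tag = Out | Low nat nat | Top nat | Infin

instance tag :: countable by countable_datatype

text \<open>Whether a child of a node tagged \<open>t\<close> may be tagged \<open>t'\<close>: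
  ordinals strictly decrease, \<open>Infin\<close> may repeat, and below \<open>Out\<close> there is
  only \<open>Out\<close>.\<close>

fun desc :: "nat rel \<Rightarrow> tag \<Rightarrow> tag \<Rightarrow> bool" where
  "desc r t Out = True"
| "desc r Infin t = True"
| "desc r (Top k) (Top l) = (l < k)"
| "desc r (Top k) (Low a l) = True"
| "desc r (Low a k) (Low b l) = ((b, a) \<in> r - Id \<or> (b = a \<and> l < k))"
| "desc r t t' = False"

lemma desc_Out [simp]: "desc r Out t \<longleftrightarrow> t = Out"
  by (cases t) auto

lemma desc_Inf [simp]: "desc r t Infin \<longleftrightarrow> t = Infin"
  by (cases t) auto

text \<open>For an initial segment \<open>J\<close> of \<open>r\<close>, read as an ordinal, these
  are the tags of value at least \<open>\<omega> \<cdot> J\<close>. \<open>Out\<close> is never big,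
  so retagging does not change which nodes are in the tree.\<close>

fun big :: "nat set \<Rightarrow> tag \<Rightarrow> bool" where
  "big J Out = False"
| "big J (Low a k) = (a \<notin> J)"
| "big J (Top k) = True"
| "big J Infin = True"

definition tagsim :: "nat set \<Rightarrow> tag \<Rightarrow> tag \<Rightarrow> bool" where
  "tagsim J t t' \<longleftrightarrow> t = t' \<or> (big J t \<and> big J t')"

type_synonym node = "bool \<times> nat list"
type_synonym cond = "node \<Rightarrow> tag option"

text \<open>Nodes are read backwards: the parent of \<open>(b, k # s)\<close> is \<open>(b, s)\<close>, and \<open>b\<close> tells to
  which of the two trees the node belongs.\<close>

definition conds :: "nat rel \<Rightarrow> cond set" where
  "conds r = {p. finite (dom p) \<and>
     (\<forall>b k s t. p (b, k # s) = Some t \<longrightarrow> (\<exists>t'. p (b, s) = Some t' \<and> desc r t' t)) \<and>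
     (\<forall>n a k. p n = Some (Low a k) \<longrightarrow> a \<in> Field r)}"

definition sim :: "nat set \<Rightarrow> cond \<Rightarrow> cond \<Rightarrow> bool" where
  "sim J p p' \<longleftrightarrow> dom p = dom p' \<and> (\<forall>n\<in>dom p. tagsim J (the (p n)) (the (p' n)))"

lemma sim_sym: "sim J p p' \<Longrightarrow> sim J p' p"
  unfolding sim_def tagsim_def by (simp, metis)

text \<open>Countability allows the dense sets attached to all conditions to be met at once, and it
  feeds the final pigeonhole argument.\<close>

lemma countable_conds: "countable (conds r)"
proof -
  have "countable (Map.graph ` conds r)"
  proof (rule countable_subset)
    show "Map.graph ` conds r \<subseteq> {A. finite A}"
      by (auto simp: conds_def)
    show "countable {A :: (node \<times> tag) set. finite A}"
      by (rule countable_Collect_finite)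
  qed
  moreover have "inj_on Map.graph (conds r)"
  proof (intro inj_onI ext)
    fix p q :: cond and n assume "Map.graph p = Map.graph q"
    then have "p n = Some t \<longleftrightarrow> q n = Some t" for t by (metis in_graphI in_graphD)
    then show "p n = q n" by (cases "p n") (metis not_Some_eq)+
  qed
  ultimately show ?thesis by (rule countable_image_inj_on)
qed

lemma conds_desc:
  "p \<in> conds r \<Longrightarrow> p (b, k # s) = Some t \<Longrightarrow> p (b, s) = Some t' \<Longrightarrow> desc r t' t"
  unfolding conds_def by fastforce

lemma conds_parent: "p \<in> conds r \<Longrightarrow> p (b, k # s) = Some t \<Longrightarrow> \<exists>t'. p (b, s) = Some t'"
  unfolding conds_def by fastforce

lemma conds_Field: "p \<in> conds r \<Longrightarrow> p n = Some (Low a k) \<Longrightarrow> a \<in> Field r"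
  unfolding conds_def by blast

lemma conds_finite: "p \<in> conds r \<Longrightarrow> finite (dom p)"
  unfolding conds_def by blast

section \<open>Retagging conditions\<close>

locale tagged_trees =
  fixes r :: "nat rel"
  assumes wo: "Well_order r"
begin

lemma total_r: "a \<in> Field r \<Longrightarrow> b \<in> Field r \<Longrightarrow> a \<noteq> b \<Longrightarrow> (a, b) \<in> r \<or> (b, a) \<in> r"
  using wo unfolding well_order_on_def linear_order_on_def total_on_def by blast

lemma antisym_r: "(a, b) \<in> r \<Longrightarrow> (b, a) \<in> r \<Longrightarrow> a = b"
  using wo unfolding well_order_on_def linear_order_on_def partial_order_on_def
  by (blast dest: antisymD)

lemma trans_r: "(a, b) \<in> r \<Longrightarrow> (b, c) \<in> r \<Longrightarrow> (a, c) \<in> r"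
  using wo unfolding well_order_on_def linear_order_on_def partial_order_on_def preorder_on_def
  by (blast dest: transD)

text \<open>Tags other than \<open>Out\<close> and \<open>Infin\<close> are ordinals, compared
  lexicographically: \<open>Low\<close> below \<open>Top\<close>, and \<open>Low\<close> by its
  index in \<open>r\<close>, then by its offset.\<close>

lemma wf_desc: "wf {(t', t). desc r t t' \<and> t' \<noteq> Out \<and> t \<noteq> Infin}"
proof -
  define m where "m t = (case t of Out \<Rightarrow> (0::nat, 0::nat, 0::nat) | Low a k \<Rightarrow> (1, a, k)
    | Top k \<Rightarrow> (2, 0, k) | Infin \<Rightarrow> (3, 0, 0))" for t
  have "wf (r - Id)" using wo unfolding well_order_on_def by blast
  then have "wf (inv_image (less_than <*lex*> (r - Id) <*lex*> less_than) m)"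
    by (intro wf_inv_image wf_lex_prod wf_less_than)
  moreover have "{(t', t). desc r t t' \<and> t' \<noteq> Out \<and> t \<noteq> Infin}
      \<subseteq> inv_image (less_than <*lex*> (r - Id) <*lex*> less_than) m"
  proof safe
    fix t t' assume "desc r t t'" "t' \<noteq> Out" "t \<noteq> Infin"
    then show "(t', t) \<in> inv_image (less_than <*lex*> (r - Id) <*lex*> less_than) m"
      by (cases t; cases t') (auto simp: m_def)
  qed
  ultimately show ?thesis by (rule wf_subset)
qed

definition initial :: "nat set \<Rightarrow> bool" where
  "initial J \<longleftrightarrow> J \<subseteq> Field r \<and> (\<forall>b\<in>J. \<forall>c. (c, b) \<in> r \<longrightarrow> c \<in> J)"

lemma initial_underS: "initial (underS r a)"
  unfolding initial_def underS_def
  using trans_r antisym_r by (auto simp: Field_def)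

lemma initial_Field: "initial (Field r)"
  unfolding initial_def by (auto simp: Field_def)

lemma initial_underS_subset: "initial J \<Longrightarrow> a \<in> J \<Longrightarrow> underS r a \<subseteq> J"
  unfolding initial_def underS_def by blast

lemma small_desc: "initial J \<Longrightarrow> \<not> big J t \<Longrightarrow> desc r t t' \<Longrightarrow> \<not> big J t'"
  unfolding initial_def by (cases t; cases t') auto

text \<open>A value of at least \<open>\<omega> \<cdot> J\<close> exceeds every smaller one, by
  totality of \<open>r\<close>. So small tags still fit under a big tag that has been replaced by
  another big one.\<close>

lemma big_desc_small:
  assumes "initial J" "big J t" "\<not> big J t'" "\<And>a k. t = Low a k \<Longrightarrow> a \<in> Field r"
  shows "desc r t t'"
proof (cases "\<exists>a k b l. t = Low a k \<and> t' = Low b l")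
  case True
  then obtain a k b l where t: "t = Low a k" "t' = Low b l" by blast
  with assms have "a \<in> Field r" "b \<in> Field r" "(a, b) \<notin> r" "a \<noteq> b"
    unfolding initial_def by auto
  with total_r t show ?thesis by auto
next
  case False
  with assms(2,3) show ?thesis by (cases t; cases t') auto
qed

text \<open>The retagging lemma of Steel forcing: new nodes whose tag need not be remembered receive
  tags just above \<open>\<omega> \<cdot> a\<close>, which fit below every old tag that is only known to be at
  least \<open>\<omega> \<cdot> J\<close>.\<close>

lemma sim_extend:
  assumes J: "initial J" and a: "a \<in> J"
    and p: "p \<in> conds r" and p': "p' \<in> conds r" and pp': "sim J p p'"
    and q: "q \<in> conds r" and pq: "p \<subseteq>\<^sub>m q"
  obtains q' where "q' \<in> conds r" "p' \<subseteq>\<^sub>m q'" "sim (underS r a) q q'"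
proof -
  let ?I = "underS r a"
  have I: "initial ?I" by (rule initial_underS)
  have IJ: "?I \<subseteq> J" using initial_underS_subset[OF J a] .
  have aF: "a \<in> Field r" using J a unfolding initial_def by blast
  have bigIJ: "big J t \<Longrightarrow> big ?I t" for t using IJ by (cases t) auto
  have aI: "a \<notin> ?I" unfolding underS_def by blast
  have dom: "dom p' = dom p" using pp' unfolding sim_def by simp
  have old: "q n = p n" if "n \<in> dom p" for n using pq that unfolding map_le_def by simp
  obtain N where N: "\<And>n. n \<in> dom q \<Longrightarrow> length (snd n) < N"
    using conds_finite[OF q] finite_nat_set_iff_bounded[of "(length \<circ> snd) ` dom q"] by auto
  \<comment> \<open>Nodes at or below an old node with a small tag. That tag is the same in
    \<open>p\<close> and \<open>p'\<close>, so the new tags under it can be copied.\<close>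
  define S where "S = (\<lambda>(b, s). \<exists>i t. p (b, drop i s) = Some t \<and> \<not> big J t)"
  \<comment> \<open>Old nodes take their tag from \<open>p'\<close>. A new tag that has to change
    becomes \<open>Low a\<close> with an offset that shrinks with depth; \<open>N\<close> exceeds
    every depth.\<close>
  define f where "f n t = (if n \<in> dom p then the (p' n)
    else if \<not> big ?I t \<or> S n then t else Low a (N - length (snd n)))" for n t
  define q' where "q' n = map_option (f n) (q n)" for n
  have Ssmall: "\<not> big J t" if "q (b, s) = Some t" "S (b, s)" for b s t
    using that
  proof (induction s arbitrary: t)
    case Nil
    then show ?case using old[of "(b, [])"] unfolding S_def by (auto simp: domI)
  next
    case (Cons k s)
    from Cons.prems(2) obtain i t1 where i: "p (b, drop i (k # s)) = Some t1" "\<not> big J t1"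
      unfolding S_def by auto
    show ?case
    proof (cases i)
      case 0
      then show ?thesis using i Cons.prems(1) old[of "(b, k # s)"] by auto
    next
      case (Suc j)
      then have "S (b, s)" using i unfolding S_def by auto
      moreover obtain t' where t': "q (b, s) = Some t'" using conds_parent[OF q Cons.prems(1)] by blast
      ultimately have "\<not> big J t'" using Cons.IH by blast
      then show ?thesis using small_desc[OF J] conds_desc[OF q Cons.prems(1) t'] by blast
    qed
  qed
  have Sstep: "S (b, k # s) = S (b, s)" if "(b, k # s) \<notin> dom p" for b k s
  proof
    assume "S (b, k # s)"
    then obtain i t1 where i: "p (b, drop i (k # s)) = Some t1" "\<not> big J t1"
      unfolding S_def by auto
    with that show "S (b, s)" unfolding S_def by (cases i) auto
  next
    assume "S (b, s)"
    then obtain i t1 where i: "p (b, drop i s) = Some t1" "\<not> big J t1"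
      unfolding S_def by auto
    then show "S (b, k # s)" unfolding S_def by (auto intro!: exI[of _ "Suc i"])
  qed
  have q'p': "p' \<subseteq>\<^sub>m q'"
    unfolding map_le_def
  proof
    fix n assume n: "n \<in> dom p'"
    then have "n \<in> dom p" using dom by simp
    with old[of n] n show "p' n = q' n" unfolding q'_def f_def by auto
  qed
  have "q' \<in> conds r"
    unfolding conds_def mem_Collect_eq
  proof (intro conjI allI impI)
    show "finite (dom q')" using conds_finite[OF q] unfolding q'_def by (simp add: dom_def)
  next
    fix n c k assume "q' n = Some (Low c k)"
    then obtain t where t: "q n = Some t" "f n t = Low c k" unfolding q'_def by auto
    show "c \<in> Field r"
    proof (cases "n \<in> dom p")
      case True
      with dom obtain t1 where "p' n = Some t1" by blast
      with True t(2) have "p' n = Some (Low c k)" unfolding f_def by simp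
      then show ?thesis using conds_Field[OF p'] by blast
    next
      case False
      then show ?thesis using t aF conds_Field[OF q] unfolding f_def by (auto split: if_splits)
    qed
  next
    fix b k s u assume "q' (b, k # s) = Some u"
    then obtain t where t: "q (b, k # s) = Some t" and u: "u = f (b, k # s) t"
      unfolding q'_def by auto
    obtain t0 where t0: "q (b, s) = Some t0" using conds_parent[OF q t] by blast
    have d: "desc r t0 t" by (rule conds_desc[OF q t t0])
    have "desc r (f (b, s) t0) (f (b, k # s) t)"
    proof (cases "(b, k # s) \<in> dom p")
      case True
      with dom obtain t1 where t1: "p' (b, k # s) = Some t1" by blast
      obtain t2 where t2: "p' (b, s) = Some t2" using conds_parent[OF p' t1] by blast
      have "(b, s) \<in> dom p" using t2 dom by blast
      with True show ?thesis using conds_desc[OF p' t1 t2] t1 t2 unfolding f_def by simp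
    next
      case new: False
      show ?thesis
      proof (cases "(b, s) \<in> dom p")
        case True
        with old t0 have pt0: "p (b, s) = Some t0" by simp
        obtain t2 where t2: "p' (b, s) = Some t2" using True dom by blast
        have ts: "tagsim J t0 t2" using pp' True pt0 t2 unfolding sim_def by (metis option.sel)
        have f0: "f (b, s) t0 = t2" using True t2 unfolding f_def by simp
        show ?thesis
        \<comment> \<open>An old parent meets a new child. Under a big parent the child's tag is
          small for \<open>J\<close>, being a kept small tag or \<open>Low a\<close> with
          \<open>a \<in> J\<close>; under a small parent both tags are unchanged.\<close>
        proof (cases "big J t0")
          case bigt0: True
          then have "big J t2" using ts unfolding tagsim_def by auto
          moreover have "\<not> big J (f (b, k # s) t)"
            using new a Ssmall[OF t] bigIJ unfolding f_def by auto
          ultimately show ?thesis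
            unfolding f0 using big_desc_small[OF J] conds_Field[OF p'] t2 by blast
        next
          case False
          then have "t2 = t0" using ts unfolding tagsim_def by auto
          moreover have "S (b, s)" using pt0 False unfolding S_def by (auto intro!: exI[of _ 0])
          then have "f (b, k # s) t = t" using new Sstep[OF new] unfolding f_def by simp
          ultimately show ?thesis using d f0 by simp
        qed
      next
        case False
        \<comment> \<open>Both nodes are new. This bound makes the truncated
          \<open>N - length s\<close> strictly decrease from parent to child.\<close>
        have l: "Suc (length s) < N" using N[of "(b, k # s)"] t by auto
        show ?thesis
          using new False Sstep[OF new] d l small_desc[OF I _ d] aF aI
            big_desc_small[OF I, of "Low a (N - length s)" t]
          unfolding f_def by auto
      qed
    qed
    then show "\<exists>t'. q' (b, s) = Some t' \<and> desc r t' u"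
      using t0 u unfolding q'_def by auto
  qed
  moreover have "sim ?I q q'"
    unfolding sim_def
  proof (intro conjI ballI)
    show "dom q = dom q'" unfolding q'_def by (auto simp: dom_def)
    fix n assume "n \<in> dom q"
    then obtain t where t: "q n = Some t" by blast
    have "tagsim ?I t (f n t)"
    proof (cases "n \<in> dom p")
      case True
      with old t have "p n = Some t" by simp
      then have "tagsim J t (the (p' n))" using pp' True unfolding sim_def by (metis option.sel)
      then show ?thesis using True bigIJ unfolding tagsim_def f_def by auto
    next
      case False
      then show ?thesis using aI unfolding tagsim_def f_def by auto
    qed
    then show "tagsim ?I (the (q n)) (the (q' n))" using t unfolding q'_def by simp
  qed
  ultimately show thesis using that q'p' by blast
qed

text \<open>Replacing \<open>Infin\<close> by \<open>Top\<close> tags makes the generic tree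
  \<open>\<not> b\<close> well-founded and leaves tree \<open>b\<close> alone. Both kinds of tag are
  big for \<open>Field r\<close>, so sets of level \<open>r\<close> cannot tell the
  difference.\<close>

lemma retag_Infin:
  assumes p: "p \<in> conds r" and root: "p (\<not> b, []) = Some Infin"
  obtains p' k where "p' \<in> conds r" "sim (Field r) p p'"
    "p' (\<not> b, []) = Some (Top k)" "p' (b, []) = p (b, [])"
proof -
  define tp where "tp t = (case t of Top k \<Rightarrow> k | _ \<Rightarrow> 0)" for t
  \<comment> \<open>Bounding depth plus \<open>Top\<close> offset puts
    \<open>Top (N - depth)\<close> above an old \<open>Top\<close> child and a retagged child
    alike.\<close>
  define M where "M n = length (snd n) + tp (the (p n))" for n :: node
  obtain N where N: "\<And>n. n \<in> dom p \<Longrightarrow> M n < N"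
    using conds_finite[OF p] finite_nat_set_iff_bounded[of "M ` dom p"] by auto
  define f where "f n t = (if fst n \<noteq> b \<and> t = Infin then Top (N - length (snd n)) else t)" for n :: node and t
  define p' where "p' n = map_option (f n) (p n)" for n
  have dom: "dom p' = dom p" unfolding p'_def by (auto simp: dom_def)
  show thesis
  proof (rule that[of p' N])
    show "p' \<in> conds r"
      unfolding conds_def mem_Collect_eq
    proof (intro conjI allI impI)
      show "finite (dom p')" unfolding dom using conds_finite[OF p] .
      show "a \<in> Field r" if "p' n = Some (Low a k)" for n a k
        using that conds_Field[OF p, of n a k] unfolding p'_def f_def
        by (cases "p n") (simp_all split: if_splits)
      fix c k s u assume "p' (c, k # s) = Some u"
      then obtain t where t: "p (c, k # s) = Some t" and u: "u = f (c, k # s) t"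
        unfolding p'_def by auto
      obtain t0 where t0: "p (c, s) = Some t0" using conds_parent[OF p t] by blast
      have d: "desc r t0 t" by (rule conds_desc[OF p t t0])
      have "M (c, k # s) < N" using N t by blast
      then have "Suc (length s) + tp t < N" unfolding M_def using t by simp
      then have "desc r (f (c, s) t0) (f (c, k # s) t)"
        using d unfolding f_def tp_def by (cases t0; cases t) auto
      then show "\<exists>t'. p' (c, s) = Some t' \<and> desc r t' u"
        using t0 u unfolding p'_def by auto
    qed
    show "sim (Field r) p p'"
      unfolding sim_def dom by (auto simp: p'_def f_def tagsim_def split: if_splits)
    show "p' (\<not> b, []) = Some (Top N)"
      using root unfolding p'_def f_def by simp
    show "p' (b, []) = p (b, [])"
      unfolding p'_def f_def by (cases "p (b, [])") auto
  qed
qed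

end

lemma infinite_node: "infinite (UNIV :: node set)"
  by (simp add: finite_prod infinite_UNIV_listI)

subsection \<open>Forcing with finite tagged trees\<close>

context tagged_trees
begin

definition filt :: "cond set \<Rightarrow> bool" where
  "filt G \<longleftrightarrow> G \<subseteq> conds r \<and> (\<forall>p\<in>G. \<forall>q\<in>G. \<exists>w\<in>G. p \<subseteq>\<^sub>m w \<and> q \<subseteq>\<^sub>m w) \<and>
     (\<forall>p\<in>G. \<forall>q\<in>conds r. q \<subseteq>\<^sub>m p \<longrightarrow> q \<in> G)"

definition dense :: "cond set \<Rightarrow> bool" where
  "dense D \<longleftrightarrow> (\<forall>p\<in>conds r. \<exists>q\<in>conds r \<inter> D. p \<subseteq>\<^sub>m q)"

text \<open>Forcing without a ground model: a countable family \<open>\<D>\<close> plays the part of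
  the dense sets of the model, so any predicate of filters can be forced. Larger maps are stronger
  conditions.\<close>

definition forces :: "cond \<Rightarrow> (cond set \<Rightarrow> bool) \<Rightarrow> bool" where
  "forces p Q \<longleftrightarrow> (\<exists>\<D>. countable \<D> \<and> (\<forall>D\<in>\<D>. dense D) \<and>
     (\<forall>G. filt G \<longrightarrow> p \<in> G \<longrightarrow> (\<forall>D\<in>\<D>. G \<inter> D \<noteq> {}) \<longrightarrow> Q G))"

definition tree_of :: "cond set \<Rightarrow> node \<Rightarrow> bool" where
  "tree_of G n \<longleftrightarrow> (\<exists>p\<in>G. \<exists>t. p n = Some t \<and> t \<noteq> Out)"

definition real_of_filter :: "cond set \<Rightarrow> real" where
  "real_of_filter G = cval (1/2) (tree_of G)"

lemma real_of_filter_I01: "real_of_filter G \<in> I01"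
  unfolding real_of_filter_def by (rule cval_bounds) auto

lemma filt_ub: "filt G \<Longrightarrow> p \<in> G \<Longrightarrow> q \<in> G \<Longrightarrow> \<exists>w\<in>G. p \<subseteq>\<^sub>m w \<and> q \<subseteq>\<^sub>m w"
  unfolding filt_def by blast

lemma filt_down: "filt G \<Longrightarrow> p \<in> G \<Longrightarrow> q \<in> conds r \<Longrightarrow> q \<subseteq>\<^sub>m p \<Longrightarrow> q \<in> G"
  unfolding filt_def by blast

lemma filt_conds: "filt G \<Longrightarrow> p \<in> G \<Longrightarrow> p \<in> conds r"
  unfolding filt_def by blast

lemma filt_agree:
  assumes "filt G" "p \<in> G" "q \<in> G" "p n = Some t" "q n = Some t'"
  shows "t = t'"
proof -
  obtain w where "p \<subseteq>\<^sub>m w" "q \<subseteq>\<^sub>m w" using filt_ub[OF assms(1-3)] by blast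
  then have "w n = Some t" "w n = Some t'" using assms(4,5) by (metis domI map_le_def)+
  then show ?thesis by simp
qed

lemma tree_of_iff: "filt G \<Longrightarrow> p \<in> G \<Longrightarrow> p n = Some t \<Longrightarrow> tree_of G n \<longleftrightarrow> t \<noteq> Out"
  unfolding tree_of_def using filt_agree by blast

lemma rasiowa_sikorski:
  assumes p: "p \<in> conds r" and "countable \<D>" and D: "\<And>D. D \<in> \<D> \<Longrightarrow> dense D"
  obtains G where "filt G" "p \<in> G" "\<And>D. D \<in> \<D> \<Longrightarrow> G \<inter> D \<noteq> {}"
proof -
  define E where "E = from_nat_into (insert UNIV \<D>)"
  have cE: "countable (insert UNIV \<D>)" using assms(2) by simp
  have "dense UNIV" unfolding dense_def by (auto intro: map_le_refl)
  then have dE: "dense (E n)" for n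
    using D from_nat_into[of "insert UNIV \<D>" n] unfolding E_def by auto
  have "\<exists>c. c 0 = p \<and> (\<forall>n. c n \<in> conds r) \<and> (\<forall>n. c n \<subseteq>\<^sub>m c (Suc n) \<and> c (Suc n) \<in> E n)"
  proof -
    have "\<exists>c. \<forall>n. (c n \<in> conds r \<and> (n = 0 \<longrightarrow> c n = p)) \<and> (c n \<subseteq>\<^sub>m c (Suc n) \<and> c (Suc n) \<in> E n)"
      by (rule dependent_nat_choice) (use p dE in \<open>auto simp: dense_def\<close>)
    then show ?thesis by blast
  qed
  then obtain c where c: "c 0 = p" "\<And>n. c n \<in> conds r" "\<And>n. c n \<subseteq>\<^sub>m c (Suc n)" "\<And>n. c (Suc n) \<in> E n"
    by blast
  have mono: "c m \<subseteq>\<^sub>m c n" if "m \<le> n" for m n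
    using that by (induction rule: dec_induct) (auto intro: map_le_refl map_le_trans c(3))
  define G where "G = {q \<in> conds r. \<exists>n. q \<subseteq>\<^sub>m c n}"
  have cG: "c n \<in> G" for n unfolding G_def using c(2) map_le_refl by blast
  show thesis
  proof (rule that[of G])
    show "filt G"
      unfolding filt_def
    proof (intro conjI ballI impI)
      fix q q' assume "q \<in> G" "q' \<in> G"
      then obtain m n where "q \<subseteq>\<^sub>m c m" "q' \<subseteq>\<^sub>m c n" unfolding G_def by blast
      then have "q \<subseteq>\<^sub>m c (max m n)" "q' \<subseteq>\<^sub>m c (max m n)"
        using mono[of m "max m n"] mono[of n "max m n"] map_le_trans by auto
      then show "\<exists>w\<in>G. q \<subseteq>\<^sub>m w \<and> q' \<subseteq>\<^sub>m w" using cG by blast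
    next
      fix q q' assume "q \<in> G" "q' \<in> conds r" "q' \<subseteq>\<^sub>m q"
      then show "q' \<in> G" unfolding G_def using map_le_trans by blast
    qed (auto simp: G_def)
    show "p \<in> G" using cG[of 0] c(1) by simp
    fix D assume "D \<in> \<D>"
    then obtain n where "E n = D"
      unfolding E_def using from_nat_into_surj[OF cE, of D] by blast
    then show "G \<inter> D \<noteq> {}" using c(4)[of n] cG by blast
  qed
qed

lemma forcesE:
  assumes "forces p Q"
  obtains \<D> where "countable \<D>" "\<forall>D\<in>\<D>. dense D"
    "\<forall>G. filt G \<longrightarrow> p \<in> G \<longrightarrow> (\<forall>D\<in>\<D>. G \<inter> D \<noteq> {}) \<longrightarrow> Q G"
proof -
  from assms obtain \<D> where "countable \<D> \<and> (\<forall>D\<in>\<D>. dense D) \<and>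
     (\<forall>G. filt G \<longrightarrow> p \<in> G \<longrightarrow> (\<forall>D\<in>\<D>. G \<inter> D \<noteq> {}) \<longrightarrow> Q G)"
    unfolding forces_def by (rule exE)
  then show thesis by (intro that[of \<D>]) simp_all
qed

lemma forces_ex:
  assumes "p \<in> conds r" "forces p Q"
  obtains G where "filt G" "p \<in> G" "Q G"
proof -
  obtain \<D> where \<D>: "countable \<D>" "\<forall>D\<in>\<D>. dense D"
    "\<forall>G. filt G \<longrightarrow> p \<in> G \<longrightarrow> (\<forall>D\<in>\<D>. G \<inter> D \<noteq> {}) \<longrightarrow> Q G"
    by (rule forcesE[OF assms(2)])
  obtain G where G: "filt G" "p \<in> G" "\<And>D. D \<in> \<D> \<Longrightarrow> G \<inter> D \<noteq> {}"
    using rasiowa_sikorski[OF assms(1) \<D>(1)] \<D>(2) by blast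
  show thesis by (rule that[OF G(1,2)]) (use \<D>(3) G in simp)
qed

lemma forces_mono:
  assumes "forces p Q" "\<And>G. filt G \<Longrightarrow> p \<in> G \<Longrightarrow> Q G \<Longrightarrow> Q' G"
  shows "forces p Q'"
proof -
  obtain \<D> where "countable \<D>" "\<forall>D\<in>\<D>. dense D"
    "\<forall>G. filt G \<longrightarrow> p \<in> G \<longrightarrow> (\<forall>D\<in>\<D>. G \<inter> D \<noteq> {}) \<longrightarrow> Q G"
    by (rule forcesE[OF assms(1)])
  then show ?thesis unfolding forces_def by (intro exI[of _ \<D>]) (simp add: assms(2))
qed

lemma forces_dense: "dense D \<Longrightarrow> forces p (\<lambda>G. G \<inter> D \<noteq> {})"
  unfolding forces_def by (rule exI[of _ "{D}"]) auto

lemma forces_extend: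
  assumes "p \<in> conds r" "p \<subseteq>\<^sub>m q" "forces p Q"
  shows "forces q Q"
proof -
  obtain \<D> where "countable \<D>" "\<forall>D\<in>\<D>. dense D"
    "\<forall>G. filt G \<longrightarrow> p \<in> G \<longrightarrow> (\<forall>D\<in>\<D>. G \<inter> D \<noteq> {}) \<longrightarrow> Q G"
    by (rule forcesE[OF assms(3)])
  then show ?thesis
    unfolding forces_def using filt_down[OF _ _ assms(1,2)] by (intro exI[of _ \<D>]) simp
qed

lemma forces_ball:
  assumes "countable I" "\<And>i. i \<in> I \<Longrightarrow> forces p (Q i)"
  shows "forces p (\<lambda>G. \<forall>i\<in>I. Q i G)"
proof -
  define \<D> where "\<D> i = (SOME \<D>. countable \<D> \<and> (\<forall>D\<in>\<D>. dense D) \<and>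
     (\<forall>G. filt G \<longrightarrow> p \<in> G \<longrightarrow> (\<forall>D\<in>\<D>. G \<inter> D \<noteq> {}) \<longrightarrow> Q i G))" for i
  have \<D>: "countable (\<D> i) \<and> (\<forall>D\<in>\<D> i. dense D) \<and>
     (\<forall>G. filt G \<longrightarrow> p \<in> G \<longrightarrow> (\<forall>D\<in>\<D> i. G \<inter> D \<noteq> {}) \<longrightarrow> Q i G)" if "i \<in> I" for i
    unfolding \<D>_def using assms(2)[OF that] unfolding forces_def by (rule someI_ex)
  show ?thesis
    unfolding forces_def
  proof (intro exI[of _ "\<Union>i\<in>I. \<D> i"] conjI allI impI ballI)
    show "countable (\<Union>i\<in>I. \<D> i)" using \<D> assms(1) by (intro countable_UN) auto
    show "dense D" if "D \<in> (\<Union>i\<in>I. \<D> i)" for D using that \<D> by blast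
    show "Q i G" if "filt G" "p \<in> G" "\<forall>D\<in>(\<Union>i\<in>I. \<D> i). G \<inter> D \<noteq> {}" "i \<in> I" for G i
      using \<D>[OF that(4)] that by simp
  qed
qed

lemma forces_conj:
  assumes "forces p Q" "forces p Q'"
  shows "forces p (\<lambda>G. Q G \<and> Q' G)"
proof -
  have "forces p (\<lambda>G. \<forall>b\<in>(UNIV :: bool set). (if b then Q else Q') G)"
    by (rule forces_ball) (use assms in auto)
  then show ?thesis by (rule forces_mono) (auto simp: UNIV_bool)
qed

lemma forces_contradiction:
  assumes "p \<in> conds r" "forces p Q" "forces p (\<lambda>G. \<not> Q G)"
  shows False
  using forces_ex[OF assms(1) forces_conj[OF assms(2,3)]] by blast

lemma forces_local:
  assumes p: "p \<in> conds r"
    and loc: "\<And>q. q \<in> conds r \<Longrightarrow> p \<subseteq>\<^sub>m q \<Longrightarrow> \<exists>w\<in>conds r. q \<subseteq>\<^sub>m w \<and> forces w Q"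
  shows "forces p Q"
proof -
  define W where "W = {w \<in> conds r. forces w Q}"
  \<comment> \<open>A filter through \<open>p\<close> contains nothing incompatible with
    \<open>p\<close>, so meeting \<open>D\<close> puts a member of \<open>W\<close> into it. As
    \<open>W\<close> is countable, the dense sets witnessing all its members can be met
    together.\<close>
  define D where "D = {q. (\<exists>w\<in>W. w \<subseteq>\<^sub>m q) \<or> \<not> (\<exists>v\<in>conds r. p \<subseteq>\<^sub>m v \<and> q \<subseteq>\<^sub>m v)}"
  have "dense D"
    unfolding dense_def
  proof
    fix q assume q: "q \<in> conds r"
    show "\<exists>q'\<in>conds r \<inter> D. q \<subseteq>\<^sub>m q'"
    proof (cases "\<exists>v\<in>conds r. p \<subseteq>\<^sub>m v \<and> q \<subseteq>\<^sub>m v")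
      case True
      then obtain v where v: "v \<in> conds r" "p \<subseteq>\<^sub>m v" "q \<subseteq>\<^sub>m v" by blast
      then obtain w where "w \<in> conds r" "v \<subseteq>\<^sub>m w" "forces w Q" using loc by blast
      then show ?thesis unfolding D_def W_def using v map_le_trans map_le_refl by blast
    next
      case False
      then show ?thesis unfolding D_def using q map_le_refl by blast
    qed
  qed
  then have D: "forces p (\<lambda>G. G \<inter> D \<noteq> {})" by (rule forces_dense)
  have "countable W" unfolding W_def by (rule countable_subset[OF _ countable_conds]) auto
  then have W: "forces p (\<lambda>G. \<forall>w\<in>W. w \<in> G \<longrightarrow> Q G)"
  proof (rule forces_ball)
    fix w assume "w \<in> W"
    then obtain \<D> where "countable \<D>" "\<forall>D\<in>\<D>. dense D"
      "\<forall>G. filt G \<longrightarrow> w \<in> G \<longrightarrow> (\<forall>D\<in>\<D>. G \<inter> D \<noteq> {}) \<longrightarrow> Q G"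
      unfolding W_def using forcesE by blast
    then show "forces p (\<lambda>G. w \<in> G \<longrightarrow> Q G)"
      unfolding forces_def by (intro exI[of _ \<D>]) simp
  qed
  show ?thesis
  proof (rule forces_mono[OF forces_conj[OF D W]])
    fix G assume G: "filt G" "p \<in> G" "G \<inter> D \<noteq> {} \<and> (\<forall>w\<in>W. w \<in> G \<longrightarrow> Q G)"
    then obtain q where q: "q \<in> G" "q \<in> D" by blast
    have "\<exists>v\<in>conds r. p \<subseteq>\<^sub>m v \<and> q \<subseteq>\<^sub>m v" using filt_ub[OF G(1,2) q(1)] filt_conds[OF G(1)] by blast
    with q obtain w where "w \<in> W" "w \<subseteq>\<^sub>m q" unfolding D_def by blast
    then show "Q G" using filt_down[OF G(1) q(1)] G(3) unfolding W_def by blast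
  qed
qed

text \<open>The counterpart of the Baire property: not automatic for arbitrary \<open>Q\<close>, it
  is supplied for Borel sets by \<open>decided_Sigma0\<close>.\<close>

definition decided :: "(cond set \<Rightarrow> bool) \<Rightarrow> bool" where
  "decided Q \<longleftrightarrow> (\<forall>p\<in>conds r. \<exists>q\<in>conds r. p \<subseteq>\<^sub>m q \<and> (forces q Q \<or> forces q (\<lambda>G. \<not> Q G)))"

lemma decided_not: "decided Q \<Longrightarrow> decided (\<lambda>G. \<not> Q G)"
  unfolding decided_def by auto

lemma decided_forces_not:
  assumes "decided Q" "p \<in> conds r" "\<And>q. q \<in> conds r \<Longrightarrow> p \<subseteq>\<^sub>m q \<Longrightarrow> \<not> forces q Q"
  shows "forces p (\<lambda>G. \<not> Q G)"
proof (rule forces_local[OF assms(2)])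
  fix q assume q: "q \<in> conds r" "p \<subseteq>\<^sub>m q"
  then obtain w where w: "w \<in> conds r" "q \<subseteq>\<^sub>m w" "forces w Q \<or> forces w (\<lambda>G. \<not> Q G)"
    using assms(1) unfolding decided_def by meson
  moreover have "\<not> forces w Q" using assms(3)[OF w(1) map_le_trans[OF q(2) w(2)]] .
  ultimately show "\<exists>w\<in>conds r. q \<subseteq>\<^sub>m w \<and> forces w (\<lambda>G. \<not> Q G)" by auto
qed

text \<open>If no extension forced any \<open>Q i\<close>, then \<open>p\<close> would force each
  negation, hence by countability all of them together.\<close>

lemma forces_bex:
  assumes "countable I" "p \<in> conds r" "forces p (\<lambda>G. \<exists>i\<in>I. Q i G)" "\<And>i. i \<in> I \<Longrightarrow> decided (Q i)"
  shows "\<exists>i\<in>I. \<exists>q\<in>conds r. p \<subseteq>\<^sub>m q \<and> forces q (Q i)"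
proof (rule ccontr)
  assume *: "\<not> ?thesis"
  have "forces p (\<lambda>G. \<not> Q i G)" if "i \<in> I" for i
  proof (rule decided_forces_not[OF assms(4)[OF that] assms(2)])
    show "\<not> forces q (Q i)" if "q \<in> conds r" "p \<subseteq>\<^sub>m q" for q
      using * \<open>i \<in> I\<close> that by auto
  qed
  then have "forces p (\<lambda>G. \<forall>i\<in>I. \<not> Q i G)" by (rule forces_ball[OF assms(1)])
  then have "forces p (\<lambda>G. \<not> (\<exists>i\<in>I. Q i G))" by simp
  then show False by (rule forces_contradiction[OF assms(2,3)])
qed

section \<open>Dense sets and generic filters\<close>

lemma conds_add:
  assumes q: "q \<in> conds r" and n: "q (b, s) = None"
    and par: "\<And>k s'. s = k # s' \<Longrightarrow> \<exists>t'. q (b, s') = Some t' \<and> desc r t' t"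
    and F: "\<And>a k. t = Low a k \<Longrightarrow> a \<in> Field r"
  shows "q((b, s) \<mapsto> t) \<in> conds r"
  unfolding conds_def mem_Collect_eq
proof (intro conjI allI impI)
  show "finite (dom (q((b, s) \<mapsto> t)))" using conds_finite[OF q] by simp
next
  fix m a k assume "(q((b, s) \<mapsto> t)) m = Some (Low a k)"
  then show "a \<in> Field r" using F conds_Field[OF q] by (auto split: if_splits)
next
  fix c k u t1 assume t1: "(q((b, s) \<mapsto> t)) (c, k # u) = Some t1"
  show "\<exists>t'. (q((b, s) \<mapsto> t)) (c, u) = Some t' \<and> desc r t' t1"
  proof (cases "(c, k # u) = (b, s)")
    case True
    then show ?thesis using par[of k u] t1 by auto
  next
    case False
    then have *: "q (c, k # u) = Some t1" using t1 by (auto split: if_splits)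
    obtain t' where t': "q (c, u) = Some t'" using conds_parent[OF q *] by blast
    with n have "(c, u) \<noteq> (b, s)" by (metis option.distinct(1))
    then have "(q((b, s) \<mapsto> t)) (c, u) = Some t'" using t' by (subst fun_upd_other)
    then show ?thesis using conds_desc[OF q * t'] by blast
  qed
qed

lemma map_le_add:
  assumes "q n = None"
  shows "q \<subseteq>\<^sub>m q(n \<mapsto> t)"
  using assms by (auto simp: map_le_def)

text \<open>\<open>Out\<close> may stand below every tag, so a missing node can be added with tag
  \<open>Out\<close> once its ancestors are present.\<close>

lemma dense_dom: "dense {q. n \<in> dom q}"
proof (cases n)
  case (Pair b s)
  have "\<exists>q'\<in>conds r. (b, s) \<in> dom q' \<and> q \<subseteq>\<^sub>m q'" if q: "q \<in> conds r" for q
    using q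
  proof (induction s arbitrary: q)
    case Nil
    show ?case
    proof (cases "q (b, []) = None")
      case True
      then have "q((b, []) \<mapsto> Out) \<in> conds r" using conds_add[OF Nil, of b "[]" Out] by simp
      moreover have "q \<subseteq>\<^sub>m q((b, []) \<mapsto> Out)" using True by (rule map_le_add)
      ultimately show ?thesis by (meson domI fun_upd_same)
    next
      case False
      then show ?thesis using Nil map_le_refl by blast
    qed
  next
    case (Cons k s)
    obtain q1 where q1: "q1 \<in> conds r" "(b, s) \<in> dom q1" "q \<subseteq>\<^sub>m q1" using Cons by blast
    show ?case
    proof (cases "q1 (b, k # s) = None")
      case True
      have "q1((b, k # s) \<mapsto> Out) \<in> conds r"
        using conds_add[OF q1(1) True, of Out] q1(2) by auto
      moreover have "q \<subseteq>\<^sub>m q1((b, k # s) \<mapsto> Out)"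
        using map_le_trans[OF q1(3) map_le_add[where q = q1, OF True]] .
      ultimately show ?thesis by (meson domI fun_upd_same)
    next
      case False
      then show ?thesis using q1 by blast
    qed
  qed
  then show ?thesis unfolding dense_def using Pair by blast
qed

lemma fresh_child:
  assumes "finite (A :: node set)"
  obtains k where "(b, k # s) \<notin> A"
proof -
  have "inj (\<lambda>k::nat. (b, k # s))" by (rule injI) simp
  then have "infinite (range (\<lambda>k::nat. (b, k # s)))" by (rule range_inj_infinite)
  then have "\<not> range (\<lambda>k::nat. (b, k # s)) \<subseteq> A" using assms finite_subset by blast
  then show thesis using that by blast
qed

text \<open>\<open>Infin\<close> may stand below \<open>Infin\<close>, and a finite condition leaves
  some child free. Iterated, this yields an infinite branch.\<close>

lemma dense_Infin_child:
  "dense {q. (b, s) \<in> dom q \<and> (q (b, s) = Some Infin \<longrightarrow> (\<exists>k. q (b, k # s) = Some Infin))}"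
  (is "dense ?D")
  unfolding dense_def
proof
  fix q0 assume "q0 \<in> conds r"
  then obtain q where q: "q \<in> conds r" "(b, s) \<in> dom q" "q0 \<subseteq>\<^sub>m q"
    using dense_dom[of "(b, s)"] unfolding dense_def by blast
  show "\<exists>q'\<in>conds r \<inter> ?D. q0 \<subseteq>\<^sub>m q'"
  proof (cases "q (b, s) = Some Infin")
    case True
    obtain k where k: "(b, k # s) \<notin> dom q" using fresh_child[OF conds_finite[OF q(1)]] .
    then have n: "q (b, k # s) = None" by blast
    have "q((b, k # s) \<mapsto> Infin) \<in> conds r"
      using conds_add[OF q(1) n, of Infin] True by auto
    moreover have "q0 \<subseteq>\<^sub>m q((b, k # s) \<mapsto> Infin)"
      using map_le_trans[OF q(3) map_le_add[where q = q, OF n]] .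
    moreover have "q((b, k # s) \<mapsto> Infin) \<in> ?D" using True by auto
    ultimately show ?thesis by blast
  next
    case False
    then show ?thesis using q by blast
  qed
qed

text \<open>This makes the generic set of nodes co-infinite, as uniqueness of its binary expansion
  requires.\<close>

lemma dense_Out:
  assumes "finite F"
  shows "dense {q. \<exists>n. n \<notin> F \<and> q n = Some Out}"
  unfolding dense_def
proof
  fix q assume "q \<in> conds r"
  then obtain q1 where q1: "q1 \<in> conds r" "(True, []) \<in> dom q1" "q \<subseteq>\<^sub>m q1"
    using dense_dom[of "(True, [])"] unfolding dense_def by blast
  obtain k where k: "(True, [k]) \<notin> dom q1 \<union> F"
    using fresh_child[of "dom q1 \<union> F" True "[]"] conds_finite[OF q1(1)] assms by blast
  then have n: "q1 (True, [k]) = None" by blast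
  have "q1((True, [k]) \<mapsto> Out) \<in> conds r"
    using conds_add[OF q1(1) n, of Out] q1(2) by auto
  moreover have "q \<subseteq>\<^sub>m q1((True, [k]) \<mapsto> Out)"
    using map_le_trans[OF q1(3) map_le_add[where q = q1, OF n]] .
  moreover have "(q1((True, [k]) \<mapsto> Out)) (True, [k]) = Some Out" by simp
  ultimately show "\<exists>q'\<in>conds r \<inter> {q. \<exists>n. n \<notin> F \<and> q n = Some Out}. q \<subseteq>\<^sub>m q'"
    using k by blast
qed

definition generic :: "cond set \<Rightarrow> bool" where
  "generic G \<longleftrightarrow> (\<forall>n. \<exists>q\<in>G. n \<in> dom q) \<and>
     (\<forall>b s. \<forall>q\<in>G. q (b, s) = Some Infin \<longrightarrow> (\<exists>k. \<exists>q'\<in>G. q' (b, k # s) = Some Infin)) \<and>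
     infinite {n. \<not> tree_of G n}"

lemma forces_generic: "forces p generic"
proof -
  have 1: "forces p (\<lambda>G. \<forall>n\<in>UNIV. G \<inter> {q. n \<in> dom q} \<noteq> {})"
    by (intro forces_ball forces_dense dense_dom) simp
  have 2: "forces p (\<lambda>G. \<forall>n\<in>UNIV. G \<inter> {q. (fst n, snd n) \<in> dom q \<and>
      (q (fst n, snd n) = Some Infin \<longrightarrow> (\<exists>k. q (fst n, k # snd n) = Some Infin))} \<noteq> {})"
    by (intro forces_ball forces_dense dense_Infin_child) simp
  have 3: "forces p (\<lambda>G. \<forall>F\<in>{F. finite F}. G \<inter> {q. \<exists>n. n \<notin> F \<and> q n = Some Out} \<noteq> {})"
    by (intro forces_ball forces_dense dense_Out countable_Collect_finite) simp
  show ?thesis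
  proof (rule forces_mono[OF forces_conj[OF 1 forces_conj[OF 2 3]]], elim conjE)
    fix G assume G: "filt G"
      and g1: "\<forall>n\<in>UNIV. G \<inter> {q. n \<in> dom q} \<noteq> {}"
      and g2: "\<forall>n\<in>UNIV. G \<inter> {q. (fst n, snd n) \<in> dom q \<and>
          (q (fst n, snd n) = Some Infin \<longrightarrow> (\<exists>k. q (fst n, k # snd n) = Some Infin))} \<noteq> {}"
      and g3: "\<forall>F\<in>{F. finite F}. G \<inter> {q. \<exists>n. n \<notin> F \<and> q n = Some Out} \<noteq> {}"
    have dom: "\<exists>q\<in>G. n \<in> dom q" for n using g1 by blast
    show "generic G"
      unfolding generic_def
    proof (intro conjI allI ballI impI)
      show "\<exists>q\<in>G. n \<in> dom q" for n by (rule dom)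
      fix b s q assume q: "q \<in> G" "q (b, s) = Some Infin"
      obtain q1 where q1: "q1 \<in> G" "(b, s) \<in> dom q1"
        "q1 (b, s) = Some Infin \<longrightarrow> (\<exists>k. q1 (b, k # s) = Some Infin)"
        using g2[rule_format, of "(b, s)"] by auto
      then have "q1 (b, s) = Some Infin" using filt_agree[OF G q(1) q1(1) q(2)] by blast
      then show "\<exists>k. \<exists>q'\<in>G. q' (b, k # s) = Some Infin" using q1 by blast
    next
      show "infinite {n. \<not> tree_of G n}"
      proof
        assume "finite {n. \<not> tree_of G n}"
        then obtain q n where "q \<in> G" "tree_of G n" "q n = Some Out"
          using g3[rule_format, of "{n. \<not> tree_of G n}"] by auto
        then show False using tree_of_iff[OF G] by simp
      qed
    qed
  qed
qed

section \<open>Forcing membership in sets of the Borel hierarchy\<close>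

lemma open_forced:
  assumes G: "filt G" "generic G" "p \<in> G" and S: "openin (top_of_set I01) S" "real_of_filter G \<in> S"
  obtains w where "w \<in> conds r" "p \<subseteq>\<^sub>m w"
    "\<And>J w'. sim J w w' \<Longrightarrow> forces w' (\<lambda>G. real_of_filter G \<in> S)"
proof -
  obtain O' where O: "open O'" "S = I01 \<inter> O'" using S(1) by (auto simp: openin_open)
  have "continuous_on UNIV (cval (1/2) :: (node \<Rightarrow> bool) \<Rightarrow> real)"
    by (rule continuous_on_cval) auto
  then have "open (cval (1/2) -` O' :: (node \<Rightarrow> bool) set)"
    using O(1) by (rule open_vimage[rotated])
  moreover have "tree_of G \<in> cval (1/2) -` O'"
    using S(2) O unfolding real_of_filter_def by simp
  ultimately obtain F where F: "finite F"
    "\<And>T. (\<And>n. n \<in> F \<Longrightarrow> T n = tree_of G n) \<Longrightarrow> T \<in> cval (1/2) -` O'"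
    by (rule open_fun_agree_finite) blast
  \<comment> \<open>The finitely many nodes on which membership in \<open>S\<close> depends are
    decided by one condition in \<open>G\<close>.\<close>
  from F(1) have "\<exists>w\<in>G. p \<subseteq>\<^sub>m w \<and> F \<subseteq> dom w"
  proof (induction F)
    case empty
    then show ?case using G(3) map_le_refl by blast
  next
    case (insert n F)
    then obtain w where w: "w \<in> G" "p \<subseteq>\<^sub>m w" "F \<subseteq> dom w" by blast
    obtain q where q: "q \<in> G" "n \<in> dom q" using G(2) unfolding generic_def by blast
    obtain v where v: "v \<in> G" "w \<subseteq>\<^sub>m v" "q \<subseteq>\<^sub>m v" using filt_ub[OF G(1) w(1) q(1)] by blast
    have "dom w \<subseteq> dom v" "dom q \<subseteq> dom v" using v(2,3) map_le_implies_dom_le by metis+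
    then have "insert n F \<subseteq> dom v" using w q by blast
    moreover have "p \<subseteq>\<^sub>m v" using w(2) v(2) by (rule map_le_trans)
    ultimately show ?case using v(1) by blast
  qed
  then obtain w where w: "w \<in> G" "p \<subseteq>\<^sub>m w" "F \<subseteq> dom w" by blast
  show thesis
  proof (rule that[OF filt_conds[OF G(1) w(1)] w(2)])
    fix J w' assume sim: "sim J w w'"
    have "real_of_filter G' \<in> S" if G': "filt G'" "w' \<in> G'" for G'
    proof -
      have *: "tree_of G' n = tree_of G n" if n: "n \<in> F" for n
      proof -
        obtain t where t: "w n = Some t" using n w(3) by blast
        obtain t' where t': "w' n = Some t'" using t sim unfolding sim_def by blast
        have "tagsim J t t'" using sim t t' unfolding sim_def by (metis domI option.sel)
        \<comment> \<open>\<open>Out\<close> is not big, so similar tags agree on membership in the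
          tree, whatever \<open>J\<close> is.\<close>
        then have "t = Out \<longleftrightarrow> t' = Out" unfolding tagsim_def by (cases t; cases t') auto
        then show ?thesis using tree_of_iff[OF G(1) w(1) t] tree_of_iff[OF G' t'] by simp
      qed
      have "tree_of G' \<in> cval (1/2) -` O'" by (rule F(2)[OF *])
      then show ?thesis using O(2) real_of_filter_I01[of G'] unfolding real_of_filter_def by simp
    qed
    then show "forces w' (\<lambda>G. real_of_filter G \<in> S)"
      unfolding forces_def by (intro exI[of _ "{}"]) simp
  qed
qed

lemma sim_refl: "sim J p p"
  unfolding sim_def tagsim_def by simp

lemma decided_Sigma0:
  assumes "Sigma0 (top_of_set I01) \<alpha> S"
  shows "decided (\<lambda>G. real_of_filter G \<in> S)"
  using assms
proof induction
  case (open_level \<alpha> S)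
  show ?case
    unfolding decided_def
  proof
    fix p assume p: "p \<in> conds r"
    show "\<exists>q\<in>conds r. p \<subseteq>\<^sub>m q \<and> (forces q (\<lambda>G. real_of_filter G \<in> S) \<or> forces q (\<lambda>G. real_of_filter G \<notin> S))"
    proof (cases "\<exists>q\<in>conds r. p \<subseteq>\<^sub>m q \<and> forces q (\<lambda>G. real_of_filter G \<in> S)")
      case False
      have "forces p (\<lambda>G. real_of_filter G \<notin> S)"
      proof (rule forces_mono[OF forces_generic])
        fix G assume G: "filt G" "p \<in> G" "generic G"
        show "real_of_filter G \<notin> S"
        proof
          assume "real_of_filter G \<in> S"
          then obtain w where "w \<in> conds r" "p \<subseteq>\<^sub>m w"
            "\<And>J w'. sim J w w' \<Longrightarrow> forces w' (\<lambda>G. real_of_filter G \<in> S)"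
            using open_forced[OF G(1,3,2) open_level(3)] by metis
          with False show False using sim_refl by blast
        qed
      qed
      then show ?thesis using p map_le_refl by blast
    qed blast
  qed
next
  case (union_level \<alpha> \<beta> A)
  have dA: "decided (\<lambda>G. real_of_filter G \<in> A n)" for n
  proof -
    have "decided (\<lambda>G. \<not> real_of_filter G \<in> topspace (top_of_set I01) - A n)"
      using union_level(2)[of n] by (intro decided_not) blast
    then show ?thesis using real_of_filter_I01 by (simp add: Diff_iff)
  qed
  show ?case
    unfolding decided_def
  proof
    fix p assume p: "p \<in> conds r"
    show "\<exists>q\<in>conds r. p \<subseteq>\<^sub>m q \<and> (forces q (\<lambda>G. real_of_filter G \<in> (\<Union>n. A n)) \<or>
        forces q (\<lambda>G. real_of_filter G \<notin> (\<Union>n. A n)))"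
    proof (cases "\<exists>q\<in>conds r. \<exists>n. p \<subseteq>\<^sub>m q \<and> forces q (\<lambda>G. real_of_filter G \<in> A n)")
      case True
      then obtain q n where q: "q \<in> conds r" "p \<subseteq>\<^sub>m q" "forces q (\<lambda>G. real_of_filter G \<in> A n)" by blast
      have "forces q (\<lambda>G. real_of_filter G \<in> (\<Union>n. A n))" by (rule forces_mono[OF q(3)]) blast
      then show ?thesis using q by blast
    next
      case False
      have "forces p (\<lambda>G. \<forall>n\<in>UNIV. \<not> real_of_filter G \<in> A n)"
        by (intro forces_ball decided_forces_not[OF dA p]) (use False in auto)
      then have "forces p (\<lambda>G. real_of_filter G \<notin> (\<Union>n. A n))" by simp
      then show ?thesis using p map_le_refl by blast
    qed
  qed
qed

text \<open>Forcing a set of level \<open>\<alpha>\<close> is, up to extension, insensitive to changes of tags beyond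
  \<open>\<omega> \<cdot> \<alpha>\<close>.\<close>

lemma transfer_Sigma0:
  assumes "Sigma0 (top_of_set I01) \<alpha> S" "initial J" "(Restr r J, \<alpha>) \<in> ordIso"
    "p \<in> conds r" "p' \<in> conds r" "sim J p p'" "forces p (\<lambda>G. real_of_filter G \<in> S)"
  shows "\<exists>q'\<in>conds r. p' \<subseteq>\<^sub>m q' \<and> forces q' (\<lambda>G. real_of_filter G \<in> S)"
  using assms
proof (induction arbitrary: J p p')
  case (open_level \<alpha> S)
  \<comment> \<open>A level 1 set still costs one application of \<open>sim_extend\<close>, which
    needs some \<open>a \<in> J\<close>.\<close>
  have "J \<noteq> {}"
  proof
    assume "J = {}"
    with open_level.prems(2) obtain f where "iso ({} :: nat rel) \<alpha> f" unfolding ordIso_def by auto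
    then have "Field \<alpha> = {}" unfolding iso_def bij_betw_def by auto
    with open_level(2) show False by simp
  qed
  then obtain a where a: "a \<in> J" by blast
  obtain G where G: "filt G" "p \<in> G" "real_of_filter G \<in> S \<and> generic G"
    using forces_ex[OF open_level.prems(3) forces_conj[OF open_level.prems(6) forces_generic]] .
  obtain w where w: "w \<in> conds r" "p \<subseteq>\<^sub>m w"
    "\<And>J w'. sim J w w' \<Longrightarrow> forces w' (\<lambda>G. real_of_filter G \<in> S)"
    using open_forced[OF G(1) _ G(2) open_level(3)] G(3) by metis
  obtain w' where "w' \<in> conds r" "p' \<subseteq>\<^sub>m w'" "sim (underS r a) w w'"
    using sim_extend[OF open_level.prems(1) a open_level.prems(3-5) w(1,2)] .
  with w(3) show ?case by blast
next
  case (union_level \<alpha> \<beta> A)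
  note J = union_level.prems(1)
  have "wo_rel.ofilter r J"
    using J wo unfolding initial_def wo_rel_def by (simp add: wo_rel.ofilter_def[unfolded wo_rel_def] under_def) blast
  then have FJ: "Field (Restr r J) = J" by (rule Field_Restr_ofilter[OF wo])
  have woJ: "Well_order (Restr r J)" using wo by (rule Well_order_Restr)
  have dA: "decided (\<lambda>G. real_of_filter G \<in> A n)" for n
  proof -
    have "decided (\<lambda>G. \<not> real_of_filter G \<in> topspace (top_of_set I01) - A n)"
      using union_level(2)[of n] by (intro decided_not decided_Sigma0) blast
    then show ?thesis using real_of_filter_I01 by (simp add: Diff_iff)
  qed
  have "forces p (\<lambda>G. \<exists>n\<in>UNIV. real_of_filter G \<in> A n)" using union_level.prems(6) by simp
  then obtain n q where q: "q \<in> conds r" "p \<subseteq>\<^sub>m q" "forces q (\<lambda>G. real_of_filter G \<in> A n)"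
    using forces_bex[OF _ union_level.prems(3), of UNIV "\<lambda>n G. real_of_filter G \<in> A n"] dA by auto
  have "(\<beta> n, \<alpha>) \<in> ordLess" using union_level(2)[of n] by blast
  then have less: "(\<beta> n, Restr r J) \<in> ordLess" using union_level.prems(2) ordLess_ordIso_trans ordIso_symmetric by blast
  then have "Well_order (\<beta> n)" unfolding ordLess_def by blast
  \<comment> \<open>As \<open>\<beta> n\<close> is below the order type of \<open>J\<close>, it is
    the order type of some \<open>underS r a\<close>. Similarity up to this segment survives the
    extension and suffices at level \<open>\<beta> n\<close>.\<close>
  with less obtain a where a: "a \<in> J" "(\<beta> n, Restr (Restr r J) (underS (Restr r J) a)) \<in> ordIso"
    using ordLess_iff_ordIso_Restr[OF woJ] FJ by auto
  have "underS (Restr r J) a = underS r a"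
    using a(1) J unfolding underS_def initial_def by blast
  moreover have "underS r a \<subseteq> J" by (rule initial_underS_subset[OF J a(1)])
  ultimately have "Restr (Restr r J) (underS (Restr r J) a) = Restr r (underS r a)" by blast
  with a(2) have ia: "(Restr r (underS r a), \<beta> n) \<in> ordIso" using ordIso_symmetric by metis
  obtain q' where q': "q' \<in> conds r" "p' \<subseteq>\<^sub>m q'" "sim (underS r a) q q'"
    using sim_extend[OF J a(1) union_level.prems(3-5) q(1,2)] .
  have "\<exists>v\<in>conds r. q' \<subseteq>\<^sub>m v \<and> forces v (\<lambda>G. real_of_filter G \<in> A n)"
  \<comment> \<open>Otherwise \<open>q'\<close> forces the complement of \<open>A n\<close>, a set
    of level \<open>\<beta> n\<close>. The induction hypothesis, used backwards from
    \<open>q'\<close> to \<open>q\<close>, gives an extension of \<open>q\<close> forcing that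
    complement, but \<open>q\<close> forces \<open>A n\<close>.\<close>
  proof (rule ccontr)
    assume *: "\<not> ?thesis"
    have "forces q' (\<lambda>G. \<not> real_of_filter G \<in> A n)"
      by (rule decided_forces_not[OF dA q'(1)]) (use * in auto)
    then have "forces q' (\<lambda>G. real_of_filter G \<in> topspace (top_of_set I01) - A n)"
      by (rule forces_mono) (use real_of_filter_I01 in auto)
    then obtain v where v: "v \<in> conds r" "q \<subseteq>\<^sub>m v"
      "forces v (\<lambda>G. real_of_filter G \<in> topspace (top_of_set I01) - A n)"
      using union_level(2)[of n] initial_underS ia q'(1) q(1) sim_sym[OF q'(3)] by blast
    have "forces v (\<lambda>G. \<not> real_of_filter G \<in> A n)" by (rule forces_mono[OF v(3)]) simp
    then show False
      using forces_contradiction[OF v(1) forces_extend[OF q(1) v(2) q(3)]] by blast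
  qed
  then obtain v where v: "v \<in> conds r" "q' \<subseteq>\<^sub>m v" "forces v (\<lambda>G. real_of_filter G \<in> A n)" by blast
  have "forces v (\<lambda>G. real_of_filter G \<in> (\<Union>n. A n))" by (rule forces_mono[OF v(3)]) blast
  moreover have "p' \<subseteq>\<^sub>m v" using q'(2) v(2) by (rule map_le_trans)
  ultimately show ?case using v(1) by blast
qed

end

subsection \<open>Well-founded and ill-founded generic trees\<close>

text \<open>Requiring all ancestors \<open>drop i s\<close> to satisfy \<open>T\<close> makes every
  predicate on nodes code two trees.\<close>

definition in_tree :: "(node \<Rightarrow> bool) \<Rightarrow> bool \<Rightarrow> nat list \<Rightarrow> bool" where
  "in_tree T b s \<longleftrightarrow> (\<forall>i. T (b, drop i s))"

lemma in_tree_Cons: "in_tree T b (k # s) \<longleftrightarrow> T (b, k # s) \<and> in_tree T b s"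
  unfolding in_tree_def
proof safe
  fix i assume "\<forall>i. T (b, drop i (k # s))"
  then show "T (b, drop i s)" by (metis drop_Suc_Cons)
next
  show "T (b, k # s)" if "\<forall>i. T (b, drop i (k # s))" using that by (metis drop0)
  show "T (b, drop i (k # s))" if "T (b, k # s)" "\<forall>i. T (b, drop i s)" for i
    using that by (cases i) auto
qed

definition branch :: "(node \<Rightarrow> bool) \<Rightarrow> bool \<Rightarrow> (nat \<Rightarrow> nat list) \<Rightarrow> bool" where
  "branch T b f \<longleftrightarrow> (\<forall>i. in_tree T b (f i) \<and> f (Suc i) \<noteq> [] \<and> tl (f (Suc i)) = f i)"

context tagged_trees
begin

lemma in_tree_generic:
  assumes "filt G" "p \<in> G" "p (b, s) = Some t" "t \<noteq> Out"
  shows "in_tree (tree_of G) b s"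
  using assms(3,4)
proof (induction s arbitrary: t)
  case Nil
  then show ?case using tree_of_iff[OF assms(1,2)] unfolding in_tree_def by simp
next
  case (Cons k s)
  have p: "p \<in> conds r" using filt_conds assms by blast
  obtain t' where t': "p (b, s) = Some t'" using conds_parent[OF p Cons.prems(1)] by blast
  then have "t' \<noteq> Out" using conds_desc[OF p Cons.prems(1) t'] Cons.prems(2) by auto
  then show ?case
    using Cons.IH[OF t'] Cons.prems tree_of_iff[OF assms(1,2)] by (simp add: in_tree_Cons)
qed

lemma generic_branch:
  assumes G: "filt G" "generic G" "p \<in> G" and p: "p (b, []) = Some Infin"
  obtains f where "branch (tree_of G) b f" "f 0 = []"
proof -
  have "\<exists>f. \<forall>i. ((\<exists>q\<in>G. q (b, f i) = Some Infin) \<and> (i = 0 \<longrightarrow> f i = [])) \<and>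
      (f (Suc i) \<noteq> [] \<and> tl (f (Suc i)) = f i)"
  proof (rule dependent_nat_choice)
    show "\<exists>s. (\<exists>q\<in>G. q (b, s) = Some Infin) \<and> (0 = 0 \<longrightarrow> s = [])" using G(3) p by blast
    fix s i assume "(\<exists>q\<in>G. q (b, s) = Some Infin) \<and> ((i::nat) = 0 \<longrightarrow> s = [])"
    then obtain k where "\<exists>q\<in>G. q (b, k # s) = Some Infin"
      using G(2) unfolding generic_def by blast
    then show "\<exists>s'. ((\<exists>q\<in>G. q (b, s') = Some Infin) \<and> (Suc i = 0 \<longrightarrow> s' = [])) \<and>
        s' \<noteq> [] \<and> tl s' = s"
      by (intro exI[of _ "k # s"]) simp
  qed
  then obtain f where f: "\<And>i. \<exists>q\<in>G. q (b, f i) = Some Infin" "f 0 = []"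
    "\<And>i. f (Suc i) \<noteq> [] \<and> tl (f (Suc i)) = f i" by blast
  have "in_tree (tree_of G) b (f i)" for i
    using f(1)[of i] in_tree_generic[OF G(1)] by blast
  then show thesis using that f(2,3) unfolding branch_def by blast
qed

text \<open>Below a root tagged \<open>Top k\<close> no tag is \<open>Infin\<close>, so along a
  branch the tags would descend forever in a well-founded relation.\<close>

lemma generic_no_branch:
  assumes G: "filt G" "generic G" "p \<in> G" and p: "p (b, []) = Some (Top k)"
  shows "\<not> branch (tree_of G) b f"
proof
  assume f: "branch (tree_of G) b f"
  have ex: "\<exists>q\<in>G. \<exists>t. q (b, s) = Some t" for s
    using G(2) unfolding generic_def by blast
  have notInf: "t \<noteq> Infin" if "q \<in> G" "q (b, s) = Some t" for q s t
    using that
  proof (induction s arbitrary: t)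
    case Nil
    then show ?case using filt_agree[OF G(1) G(3) Nil(1) p Nil(2)] by auto
  next
    case (Cons k s)
    have q: "q \<in> conds r" using filt_conds[OF G(1) Cons.prems(1)] .
    obtain t' where t': "q (b, s) = Some t'" using conds_parent[OF q Cons.prems(2)] by blast
    then show ?case using Cons.IH[OF Cons.prems(1) t'] conds_desc[OF q Cons.prems(2) t'] by auto
  qed
  define h where "h i = (SOME t. \<exists>q\<in>G. q (b, f i) = Some t)" for i
  have h: "\<exists>q\<in>G. q (b, f i) = Some (h i)" for i
    unfolding h_def by (rule someI_ex) (use ex in blast)
  have "(h (Suc i), h i) \<in> {(t', t). desc r t t' \<and> t' \<noteq> Out \<and> t \<noteq> Infin}" for i
  proof -
    obtain q where q: "q \<in> G" "q (b, f (Suc i)) = Some (h (Suc i))" using h by blast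
    obtain q1 where q1: "q1 \<in> G" "q1 (b, f i) = Some (h i)" using h by blast
    obtain k where k: "f (Suc i) = k # f i" using f unfolding branch_def by (metis list.collapse)
    have qc: "q \<in> conds r" using filt_conds[OF G(1) q(1)] .
    obtain t' where t': "q (b, f i) = Some t'" using conds_parent[OF qc] q(2) k by metis
    then have "t' = h i" using filt_agree[OF G(1) q(1) q1(1) _ q1(2)] by blast
    then have "desc r (h i) (h (Suc i))" using conds_desc[OF qc _ t'] q(2) k by metis
    moreover have "h (Suc i) \<noteq> Out"
      using f tree_of_iff[OF G(1) q] unfolding branch_def in_tree_def by (metis drop0)
    ultimately show ?thesis using notInf[OF q1] by simp
  qed
  then show False using wf_desc wf_iff_no_infinite_down_chain by blast
qed

end

subsection \<open>Comparing two trees\<close>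

text \<open>A homomorphism for the parent relation, which carries infinite branches to infinite
  branches. The root may go to any node, and so \<open>branch\<close> leaves its starting point
  free.\<close>

definition embeds :: "(node \<Rightarrow> bool) \<Rightarrow> bool \<Rightarrow> (nat list \<Rightarrow> nat list) \<Rightarrow> bool" where
  "embeds T b g \<longleftrightarrow> (\<forall>s. in_tree T b s \<longrightarrow> in_tree T (\<not> b) (g s)) \<and>
     (\<forall>k s. in_tree T b (k # s) \<longrightarrow> g (k # s) \<noteq> [] \<and> tl (g (k # s)) = g s)"

lemma in_tree_Nil: "in_tree T b s \<Longrightarrow> in_tree T b []"
  by (induction s) (auto simp: in_tree_Cons)

lemma branch_embeds: "embeds T b g \<Longrightarrow> branch T b f \<Longrightarrow> branch T (\<not> b) (g \<circ> f)"
  unfolding embeds_def branch_def comp_def by (metis list.collapse)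

text \<open>Winning positions of the second player, who moves in tree \<open>True\<close>, in the game in which the two
  players build branches and the first one to get stuck loses.\<close>

coinductive follows :: "(node \<Rightarrow> bool) \<Rightarrow> nat list \<Rightarrow> nat list \<Rightarrow> bool" for T where
  "(\<And>k. in_tree T False (k # s) \<Longrightarrow> \<exists>l. in_tree T True (l # t) \<and> follows T (k # s) (l # t))
   \<Longrightarrow> follows T s t"

text \<open>Determinacy of the game: a strategy of the second player embeds tree
  \<open>False\<close> into tree \<open>True\<close>, one of the first player does the converse. A
  tree without its root is empty and embeds trivially.\<close>

lemma ex_embeds: "\<exists>b g. embeds T b g"
proof (cases "in_tree T True [] \<and> in_tree T False []")
  case False
  then obtain b where "\<not> in_tree T b []" by blast
  then have "\<not> in_tree T b s" for s using in_tree_Nil by blast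
  then show ?thesis unfolding embeds_def by blast
next
  case True
  show ?thesis
  proof (cases "follows T [] []")
    case W: True
    define g where "g = rec_list [] (\<lambda>k s t. (SOME l. in_tree T True (l # t) \<and> follows T (k # s) (l # t)) # t)"
    have g: "g [] = []"
      "\<And>k s. g (k # s) = (SOME l. in_tree T True (l # g s) \<and> follows T (k # s) (l # g s)) # g s"
      unfolding g_def by simp_all
    have "in_tree T True (g s) \<and> follows T s (g s)" if "in_tree T False s" for s
      using that
    proof (induction s)
      case Nil
      then show ?case using True W g by simp
    next
      case (Cons k s)
      then have "follows T s (g s)" by (simp add: in_tree_Cons)
      then have "\<exists>l. in_tree T True (l # g s) \<and> follows T (k # s) (l # g s)"
        using Cons.prems by (auto elim: follows.cases)
      then show ?case unfolding g by (rule someI_ex)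
    qed
    then have "embeds T False g" unfolding embeds_def using g(2) by auto
    then show ?thesis by blast
  next
    case W: False
    \<comment> \<open>The first player is one move ahead, so the root goes to the opening move and
      every node is shifted one level down.\<close>
    define g where "g = rec_list
      [SOME k. in_tree T False [k] \<and> (\<forall>l. in_tree T True [l] \<longrightarrow> \<not> follows T [k] [l])]
      (\<lambda>l t s. (SOME k. in_tree T False (k # s) \<and>
         (\<forall>l'. in_tree T True (l' # l # t) \<longrightarrow> \<not> follows T (k # s) (l' # l # t))) # s)"
    have g: "g [] = [SOME k. in_tree T False [k] \<and> (\<forall>l. in_tree T True [l] \<longrightarrow> \<not> follows T [k] [l])]"
      "\<And>l t. g (l # t) = (SOME k. in_tree T False (k # g t) \<and>
         (\<forall>l'. in_tree T True (l' # l # t) \<longrightarrow> \<not> follows T (k # g t) (l' # l # t))) # g t"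
      unfolding g_def by simp_all
    have step: "\<exists>k. in_tree T False (k # s) \<and> (\<forall>l. in_tree T True (l # t) \<longrightarrow> \<not> follows T (k # s) (l # t))"
      if "\<not> follows T s t" for s t
      using that follows.intros[of T s t] by blast
    have "in_tree T False (g t) \<and> (\<forall>l. in_tree T True (l # t) \<longrightarrow> \<not> follows T (g t) (l # t))"
      if "in_tree T True t" for t
      using that
    proof (induction t)
      case Nil
      show ?case unfolding g using someI_ex[OF step[OF W]] .
    next
      case (Cons l t)
      then have "\<not> follows T (g t) (l # t)" by (simp add: in_tree_Cons)
      then show ?case unfolding g by (intro someI_ex[OF step])
    qed
    then have "embeds T True g" unfolding embeds_def using g(2) by auto
    then show ?thesis by blast
  qed
qed

subsection \<open>Coding embeddings by branches\<close>

definition entry :: "nat \<Rightarrow> bool \<times> nat list \<times> bool" where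
  "entry k = from_nat k"

text \<open>The requirements on an embedding are split into constraints between two entries, which
  keeps each of them local.\<close>

definition compat :: "(node \<Rightarrow> bool) \<Rightarrow> nat \<Rightarrow> nat \<Rightarrow> nat \<Rightarrow> nat \<Rightarrow> bool" where
  "compat T m k m' k' \<longleftrightarrow> fst (entry k) = fst (entry k') \<and>
     (in_tree T (fst (entry k)) (from_nat m) \<longrightarrow>
        in_tree T (\<not> fst (entry k)) (fst (snd (entry k))) \<and>
        (from_nat m \<noteq> ([] :: nat list) \<and> from_nat m' = tl (from_nat m :: nat list) \<longrightarrow>
           fst (snd (entry k)) \<noteq> [] \<and> tl (fst (snd (entry k))) = fst (snd (entry k'))))"

text \<open>\<open>Y\<close> is a finite or infinite chain of lists, again read backwards. If it is infinite, the entry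
  added at step \<open>m\<close> holds the side \<open>b\<close>, the value at \<open>from_nat m\<close> of an embedding of
  tree \<open>b\<close> into the other one, and an arbitrary bit. Each condition involves finitely many
  coordinates of \<open>T\<close> and \<open>Y\<close>, and only countably many finite chains exist.\<close>

definition codes :: "(node \<Rightarrow> bool) \<Rightarrow> (nat list \<Rightarrow> bool) \<Rightarrow> bool" where
  "codes T Y \<longleftrightarrow> (\<forall>k s. Y (k # s) \<longrightarrow> Y s) \<and>
     (\<forall>s t. Y s \<longrightarrow> Y t \<longrightarrow> length s = length t \<longrightarrow> s = t) \<and>
     (\<forall>k s k' s'. Y (k # s) \<longrightarrow> Y (k' # s') \<longrightarrow> compat T (length s) k (length s') k')"

text \<open>An infinite chain has exactly one member of each length, so its heads form a sequence of
  entries, and the pairwise constraints say that their values form an embedding.\<close>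

lemma codes_infinite:
  assumes Y: "codes T Y" and inf: "infinite {s. Y s}"
  obtains k g where "Y [k]" "embeds T (fst (entry k)) g"
proof -
  have down: "Y s" if "Y (k # s)" for k s using Y that unfolding codes_def by blast
  have uniq: "s = t" if "Y s" "Y t" "length s = length t" for s t using Y that unfolding codes_def by blast
  have comp: "compat T (length s) k (length s') k'" if "Y (k # s)" "Y (k' # s')" for k s k' s'
    using Y that unfolding codes_def by blast
  have drop: "Y (drop i s)" if "Y s" for i s
    using that
  proof (induction i arbitrary: s)
    case (Suc i)
    then show ?case using down by (cases s) auto
  qed simp
  have "\<exists>s. Y s \<and> length s = m" for m
  proof -
    have "inj_on length {s. Y s}" using uniq by (auto intro: inj_onI)
    then have "infinite (length ` {s. Y s})" using inf finite_imageD by blast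
    then obtain s where "Y s" "m < length s" unfolding infinite_nat_iff_unbounded by blast
    then show ?thesis using drop[of s "length s - m"] by (intro exI[of _ "drop (length s - m) s"]) simp
  qed
  then obtain e where e: "\<And>m. Y (e m)" "\<And>m. length (e m) = m" by metis
  define k where "k m = hd (e (Suc m))" for m
  have eS: "e (Suc m) = k m # e m" for m
  proof -
    obtain t where t: "e (Suc m) = k m # t" using e(2)[of "Suc m"] unfolding k_def by (cases "e (Suc m)") auto
    then have "Y t" "length t = m" using down e(1)[of "Suc m"] e(2)[of "Suc m"] by auto
    then show ?thesis using t uniq e by metis
  qed
  have c: "compat T m (k m) m' (k m')" for m m'
    using comp[of "k m" "e m" "k m'" "e m'"] e eS by metis
  define b where "b = fst (entry (k 0))"
  have b: "fst (entry (k m)) = b" for m using c[of m 0] unfolding compat_def b_def by blast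
  define g where "g n = fst (snd (entry (k (to_nat n))))" for n :: "nat list"
  have "embeds T b g"
    unfolding embeds_def
  proof (intro conjI allI impI)
    fix s assume "in_tree T b s"
    then show "in_tree T (\<not> b) (g s)"
      using c[of "to_nat s" 0] b unfolding compat_def g_def by simp
  next
    fix j s assume "in_tree T b (j # s)"
    then have "g (j # s) \<noteq> [] \<and> tl (g (j # s)) = g s"
      using c[of "to_nat (j # s)" "to_nat s"] b unfolding compat_def g_def by simp
    then show "g (j # s) \<noteq> []" "tl (g (j # s)) = g s" by auto
  qed
  moreover have "Y [k 0]" using e(1)[of 1] eS[of 0] e(2)[of 0] by simp
  ultimately show thesis using that unfolding b_def by blast
qed

text \<open>The spare bit in each entry yields a different code of one fixed embedding for every bit
  sequence \<open>d\<close>.\<close>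

lemma uncountable_codes: "uncountable {Y. codes T Y}"
proof -
  obtain b g where g: "embeds T b g" using ex_embeds by blast
  define y where "y d m = to_nat (b, g (from_nat m), d m)" for d :: "nat \<Rightarrow> bool" and m
  define Y where "Y d s \<longleftrightarrow> s = rev (map (y d) [0..<length s])" for d s
  have ent: "entry (y d m) = (b, g (from_nat m), d m)" for d m
    unfolding entry_def y_def by simp
  have YC: "Y d (k # s) \<longleftrightarrow> k = y d (length s) \<and> Y d s" for d k s
    unfolding Y_def by auto
  have "codes T (Y d)" for d
    unfolding codes_def
  proof (intro conjI allI impI)
    show "Y d s" if "Y d (k # s)" for k s using that YC by blast
    show "s = t" if "Y d s" "Y d t" "length s = length t" for s t using that unfolding Y_def by metis
    fix k s k' s' assume "Y d (k # s)" "Y d (k' # s')"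
    then have k: "k = y d (length s)" "k' = y d (length s')" using YC by blast+
    show "compat T (length s) k (length s') k'"
      using g unfolding compat_def k ent embeds_def by (simp, metis list.collapse)
  qed
  moreover have "inj Y"
  proof (rule injI, rule ext)
    fix d d' m assume eq: "Y d = Y d'"
    have "Y d (rev (map (y d) [0..<Suc m]))" unfolding Y_def by simp
    then have "Y d' (rev (map (y d) [0..<Suc m]))" using eq by simp
    then have "y d m = y d' m" by (simp add: YC)
    then show "d m = d' m" unfolding y_def by simp
  qed
  moreover have "uncountable (UNIV :: (nat \<Rightarrow> bool) set)"
  proof
    assume "countable (UNIV :: (nat \<Rightarrow> bool) set)"
    then obtain f :: "nat \<Rightarrow> nat \<Rightarrow> bool" where "range f = UNIV"
      by (metis UNIV_not_empty uncountable_def)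
    then obtain n where "f n = (\<lambda>m. \<not> f m m)" by (metis UNIV_I imageE)
    then show False by metis
  qed
  ultimately show ?thesis
    by (metis (mono_tags, lifting) countable_image_inj_on countable_subset image_subsetI mem_Collect_eq)
qed

section \<open>The closed set in the square and its sections\<close>

definition code_set :: "(real \<times> real) set" where
  "code_set = (\<lambda>(T, Y). (cval (1/2) T, cval (1/3) Y)) ` {(T, Y). codes T Y}"

lemma clopen_fst: "open {p :: ('a \<Rightarrow> bool) \<times> ('b \<Rightarrow> bool). fst p n}" "closed {p :: ('a \<Rightarrow> bool) \<times> ('b \<Rightarrow> bool). fst p n}"
  and clopen_snd: "open {p :: ('a \<Rightarrow> bool) \<times> ('b \<Rightarrow> bool). snd p m}" "closed {p :: ('a \<Rightarrow> bool) \<times> ('b \<Rightarrow> bool). snd p m}"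
proof -
  have c1: "continuous_on UNIV (\<lambda>p :: ('a \<Rightarrow> bool) \<times> ('b \<Rightarrow> bool). fst p n)"
    by (rule continuous_on_compose2[OF continuous_on_product_coordinates continuous_on_fst[OF continuous_on_id]]) simp
  have c2: "continuous_on UNIV (\<lambda>p :: ('a \<Rightarrow> bool) \<times> ('b \<Rightarrow> bool). snd p m)"
    by (rule continuous_on_compose2[OF continuous_on_product_coordinates continuous_on_snd[OF continuous_on_id]]) simp
  show "open {p :: ('a \<Rightarrow> bool) \<times> ('b \<Rightarrow> bool). fst p n}"
    using open_vimage[OF _ c1, of "{True}"] by (simp add: vimage_def open_discrete)
  show "closed {p :: ('a \<Rightarrow> bool) \<times> ('b \<Rightarrow> bool). fst p n}"
    using closed_vimage[OF _ c1, of "{True}"] by (simp add: vimage_def)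
  show "open {p :: ('a \<Rightarrow> bool) \<times> ('b \<Rightarrow> bool). snd p m}"
    using open_vimage[OF _ c2, of "{True}"] by (simp add: vimage_def open_discrete)
  show "closed {p :: ('a \<Rightarrow> bool) \<times> ('b \<Rightarrow> bool). snd p m}"
    using closed_vimage[OF _ c2, of "{True}"] by (simp add: vimage_def)
qed

lemma closed_in_tree: "closed {p :: (node \<Rightarrow> bool) \<times> ('b \<Rightarrow> bool). in_tree (fst p) b s}"
  unfolding in_tree_def by (intro closed_Collect_all clopen_fst)

text \<open>Only finitely many ancestors matter. Openness serves where \<open>in_tree\<close> is the
  premise of the implication in \<open>compat\<close>.\<close>

lemma open_in_tree: "open {p :: (node \<Rightarrow> bool) \<times> ('b \<Rightarrow> bool). in_tree (fst p) b s}"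
proof (induction s)
  case Nil
  then show ?case unfolding in_tree_def by (simp add: clopen_fst)
next
  case (Cons k s)
  then show ?case unfolding in_tree_Cons by (intro open_Collect_conj clopen_fst)
qed

lemma closed_codes: "closed {(T, Y). codes T Y}"
proof -
  have "closed {p. codes (fst p) (snd p)}"
    unfolding codes_def compat_def
    by (intro closed_Collect_conj closed_Collect_all closed_Collect_imp open_Collect_conj
        open_Collect_const closed_Collect_const clopen_snd closed_in_tree open_in_tree)
  then show ?thesis by (simp add: case_prod_unfold)
qed

lemma continuous_on_cval': "continuous_on UNIV (cval (1/3) :: ('a::countable \<Rightarrow> bool) \<Rightarrow> real)"
  by (rule continuous_on_cval) auto

lemma closed_code_set: "closed code_set"
proof -
  have "compact (UNIV \<inter> {(T, Y). codes T Y})"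
    using compact_Times[OF compact_UNIV_fun_bool compact_UNIV_fun_bool] closed_codes
    by (intro compact_Int_closed) (auto simp: UNIV_Times_UNIV)
  then have comp: "compact {(T, Y). codes T Y}" by simp
  have "continuous_on UNIV (cval (1/2) :: (node \<Rightarrow> bool) \<Rightarrow> real)"
    by (rule continuous_on_cval) auto
  then have "continuous_on {(T, Y). codes T Y} (\<lambda>p. (cval (1/2) (fst p), cval (1/3) (snd p)))"
    by (intro continuous_on_Pair continuous_on_compose2[OF _ continuous_on_fst[OF continuous_on_id]]
        continuous_on_compose2[OF continuous_on_cval' continuous_on_snd[OF continuous_on_id]]) auto
  then have "continuous_on {(T, Y). codes T Y} (\<lambda>(T, Y). (cval (1/2) T, cval (1/3) Y))"
    by (simp add: case_prod_unfold)
  then have "compact code_set" unfolding code_set_def using comp by (rule compact_continuous_image)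
  then show ?thesis by (rule compact_imp_closed)
qed

lemma code_set_subset: "code_set \<subseteq> I01 \<times> I01"
  unfolding code_set_def using cval_bounds[of "1/2"] cval_bounds[of "1/3"] by fastforce

lemma cval_third_inject: "cval (1/3) Y = cval (1/3) Y' \<longleftrightarrow> Y = Y'" for Y Y' :: "nat list \<Rightarrow> bool"
  using cval_inject[of "1/3" Y Y'] infinite_UNIV_listI by auto

lemma uncountable_sections:
  assumes "x \<in> I01"
  shows "uncountable {y \<in> I01. (x, y) \<in> code_set}"
proof
  assume c: "countable {y \<in> I01. (x, y) \<in> code_set}"
  obtain T :: "node \<Rightarrow> bool" where T: "cval (1/2) T = x" by (rule cval_half_surj[OF infinite_node assms])
  have "cval (1/3) ` {Y. codes T Y} \<subseteq> {y \<in> I01. (x, y) \<in> code_set}"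
    using T code_set_subset unfolding code_set_def by fastforce
  then have "countable (cval (1/3) ` {Y. codes T Y})" using c countable_subset by blast
  then have "countable {Y. codes T Y}"
    by (rule countable_image_inj_on) (simp add: inj_on_def cval_third_inject)
  then show False using uncountable_codes by blast
qed

text \<open>A set independent of \<open>T\<close> that contains the values of all finite chains, the
  points added by compactifying.\<close>

definition finite_codes :: "real set" where
  "finite_codes = cval (1/3) ` {Y :: nat list \<Rightarrow> bool. finite {s. Y s}}"

lemma countable_finite_codes: "countable finite_codes"
proof -
  have "{Y :: nat list \<Rightarrow> bool. finite {s. Y s}} \<subseteq> (\<lambda>A s. s \<in> A) ` {A. finite A}"
  proof
    fix Y :: "nat list \<Rightarrow> bool" assume "Y \<in> {Y. finite {s. Y s}}"
    then show "Y \<in> (\<lambda>A s. s \<in> A) ` {A. finite A}" by (intro image_eqI[of _ _ "{s. Y s}"]) auto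
  qed
  then show ?thesis
    unfolding finite_codes_def
    by (intro countable_image) (rule countable_subset, auto intro: countable_Collect_finite)
qed

text \<open>The side is visible in the first entry, an open condition on \<open>Y\<close>, and
  compactness of the Cantor set transfers it to the reals. So the choice of a side becomes a
  preimage to which the rank bound applies.\<close>

lemma open_side:
  "\<exists>V. open V \<and> (\<forall>Y :: nat list \<Rightarrow> bool. cval (1/3) Y \<in> V \<longleftrightarrow> (\<exists>k. Y [k] \<and> fst (entry k) = b))"
proof -
  define A where "A = {Y :: nat list \<Rightarrow> bool. \<forall>k. Y [k] \<longrightarrow> fst (entry k) \<noteq> b}"
  have "open {Y :: nat list \<Rightarrow> bool. Y [k]}" for k
    using open_vimage[OF _ continuous_on_product_coordinates, of "{True}" "[k]"]
    by (simp add: vimage_def open_discrete)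
  then have "closed A" unfolding A_def by (intro closed_Collect_all closed_Collect_imp closed_Collect_const)
  then have "compact (UNIV \<inter> A)" by (intro compact_Int_closed compact_UNIV_fun_bool)
  then have "compact (cval (1/3) ` A)"
    by (intro compact_continuous_image continuous_on_subset[OF continuous_on_cval']) auto
  then have "open (- (cval (1/3) ` A))" using compact_imp_closed by auto
  moreover have "cval (1/3) Y \<in> - (cval (1/3) ` A) \<longleftrightarrow> (\<exists>k. Y [k] \<and> fst (entry k) = b)" for Y
    by (auto simp: cval_third_inject A_def image_iff)
  ultimately show ?thesis by (intro exI[of _ "- (cval (1/3) ` A)"]) simp
qed

lemma branch_infinite: "branch T b f \<Longrightarrow> infinite {n. T n}"
proof -
  assume f: "branch T b f"
  have len: "length (f i) = i + length (f 0)" for i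
  proof (induction i)
    case (Suc i)
    have "f (Suc i) = hd (f (Suc i)) # f i" using f unfolding branch_def by (metis list.collapse)
    then show ?case using Suc by (metis add_Suc length_Cons)
  qed simp
  have "inj (\<lambda>i. (b, f i))" by (rule injI) (metis add_right_cancel len prod.inject)
  then have "infinite (range (\<lambda>i. (b, f i)))" by (rule range_inj_infinite)
  moreover have "range (\<lambda>i. (b, f i)) \<subseteq> {n. T n}"
    using f unfolding branch_def in_tree_def by (auto, metis drop0)
  ultimately show ?thesis using finite_subset by blast
qed

subsection \<open>Uniformizations of bounded rank\<close>

context tagged_trees
begin

text \<open>A branch and genericity make \<open>tree_of G\<close> infinite and co-infinite, so the
  binary expansion is unique and \<open>T\<close> can only be \<open>tree_of G\<close>.\<close>

lemma generic_section:
  assumes "filt G" "generic G" "branch (tree_of G) b f" "(real_of_filter G, z) \<in> code_set"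
    and "z \<notin> finite_codes"
  obtains Y where "z = cval (1/3) Y" "codes (tree_of G) Y" "infinite {s. Y s}"
proof -
  obtain T Y where TY: "codes T Y" "cval (1/2) (tree_of G) = cval (1/2) T" "z = cval (1/3) Y"
    using assms(4) unfolding code_set_def real_of_filter_def by auto
  have "T = tree_of G"
    using cval_half_unique[OF infinite_node TY(2) branch_infinite[OF assms(3)]] assms(2)
    unfolding generic_def by blast
  moreover have "infinite {s. Y s}" using assms(5) TY(3) unfolding finite_codes_def by blast
  ultimately show thesis using that TY by blast
qed

lemma forces_finite_code:
  assumes u: "\<And>x. x \<in> I01 \<Longrightarrow> (x, u x) \<in> code_set"
    and rank: "borel_rank_le (top_of_set I01) (top_of_set I01) u r"
  shows "\<exists>p\<in>conds r. \<exists>d\<in>finite_codes. forces p (\<lambda>G. u (real_of_filter G) = d)"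
proof (rule ccontr)
  assume no: "\<not> ?thesis"
  have u01: "u x \<in> I01" if "x \<in> I01" for x using u[OF that] code_set_subset by blast
  have S: "Sigma0 (top_of_set I01) r {x \<in> I01. u x \<in> V}" if "open V" for V
  proof -
    have "openin (top_of_set I01) (I01 \<inter> V)" using that by auto
    then have "Sigma0 (top_of_set I01) r {x \<in> topspace (top_of_set I01). u x \<in> I01 \<inter> V}"
      using rank unfolding borel_rank_le_def by blast
    moreover have "{x \<in> topspace (top_of_set I01). u x \<in> I01 \<inter> V} = {x \<in> I01. u x \<in> V}"
      using u01 by auto
    ultimately show ?thesis by simp
  qed
  \<comment> \<open>If no condition forces any particular value in \<open>finite_codes\<close>,
    every condition forces each of these countably many values to be avoided.\<close>
  have avoid: "forces p (\<lambda>G. u (real_of_filter G) \<notin> finite_codes)" if p: "p \<in> conds r" for p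
  proof -
    have "forces p (\<lambda>G. \<not> u (real_of_filter G) = d)" if d: "d \<in> finite_codes" for d
    proof (rule decided_forces_not[OF _ p])
      have "decided (\<lambda>G. \<not> real_of_filter G \<in> {x \<in> I01. u x \<in> - {d}})"
        by (intro decided_not decided_Sigma0[OF S]) auto
      then show "decided (\<lambda>G. u (real_of_filter G) = d)" using real_of_filter_I01 by simp
      show "\<not> forces q (\<lambda>G. u (real_of_filter G) = d)" if "q \<in> conds r" "p \<subseteq>\<^sub>m q" for q
        using no \<open>d \<in> finite_codes\<close> that by blast
    qed
    then have "forces p (\<lambda>G. \<forall>d\<in>finite_codes. \<not> u (real_of_filter G) = d)"
      by (rule forces_ball[OF countable_finite_codes])
    then show ?thesis by (rule forces_mono) blast
  qed
  have "\<forall>b. \<exists>V. open V \<and> (\<forall>Y :: nat list \<Rightarrow> bool. cval (1/3) Y \<in> V \<longleftrightarrow> (\<exists>k. Y [k] \<and> fst (entry k) = b))"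
    by (intro allI open_side)
  from choice[OF this] obtain V where V': "\<forall>b. open (V b) \<and>
      (\<forall>Y :: nat list \<Rightarrow> bool. cval (1/3) Y \<in> V b \<longleftrightarrow> (\<exists>k. Y [k] \<and> fst (entry k) = b))"
    by (rule exE)
  have V: "open (V b)" "cval (1/3) Y \<in> V b \<longleftrightarrow> (\<exists>k. Y [k] \<and> fst (entry k) = b)"
    for b and Y :: "nat list \<Rightarrow> bool"
    using V' by blast+
  \<comment> \<open>With both roots tagged \<open>Infin\<close>, the argument can continue whichever
    side is chosen.\<close>
  define p0 :: cond where "p0 = [(True, []) \<mapsto> Infin, (False, []) \<mapsto> Infin]"
  have p0: "p0 \<in> conds r" unfolding conds_def p0_def by (auto split: if_splits)
  have p0_Infin: "p0 (b, []) = Some Infin" for b unfolding p0_def by (cases b) auto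
  have "forces p0 (\<lambda>G. \<exists>b\<in>UNIV. real_of_filter G \<in> {x \<in> I01. u x \<in> V b})"
  proof (rule forces_mono[OF forces_conj[OF forces_generic avoid[OF p0]]], elim conjE)
    fix G assume G: "filt G" "p0 \<in> G" "generic G" "u (real_of_filter G) \<notin> finite_codes"
    obtain f where f: "branch (tree_of G) True f" using generic_branch[OF G(1,3,2) p0_Infin] .
    obtain Y where Y: "u (real_of_filter G) = cval (1/3) Y" "codes (tree_of G) Y" "infinite {s. Y s}"
      using generic_section[OF G(1,3) f u[OF real_of_filter_I01] G(4)] .
    obtain k g where "Y [k]" "embeds (tree_of G) (fst (entry k)) g" by (rule codes_infinite[OF Y(2,3)])
    then show "\<exists>b\<in>UNIV. real_of_filter G \<in> {x \<in> I01. u x \<in> V b}"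
      using real_of_filter_I01 Y(1) V(2) by auto
  qed
  then obtain b p where p: "p \<in> conds r" "p0 \<subseteq>\<^sub>m p"
    "forces p (\<lambda>G. real_of_filter G \<in> {x \<in> I01. u x \<in> V b})"
    using forces_bex[OF _ p0, of UNIV "\<lambda>b G. real_of_filter G \<in> {x \<in> I01. u x \<in> V b}"]
      decided_Sigma0[OF S[OF V(1)]] by auto
  have p_Infin: "p (c, []) = Some Infin" for c
    using p(2) p0_Infin[of c] unfolding map_le_def by (metis domI)
  \<comment> \<open>Tree \<open>\<not> b\<close> is made well-founded. Since \<open>Field r\<close>
    has order type \<open>r\<close>, transfer gives an extension of \<open>p'\<close> that still
    forces side \<open>b\<close> to be chosen.\<close>
  obtain p' k where p': "p' \<in> conds r" "sim (Field r) p p'"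
    "p' (\<not> b, []) = Some (Top k)" "p' (b, []) = p (b, [])"
    using retag_Infin[OF p(1) p_Infin] .
  have iso: "(Restr r (Field r), r) \<in> ordIso" using ordIso_reflexive[OF wo] by (simp add: Restr_Field)
  obtain q where q: "q \<in> conds r" "p' \<subseteq>\<^sub>m q" "forces q (\<lambda>G. real_of_filter G \<in> {x \<in> I01. u x \<in> V b})"
    using transfer_Sigma0[OF S[OF V(1)] initial_Field iso p(1) p'(1,2) p(3)] by blast
  obtain G where G: "filt G" "q \<in> G"
    "real_of_filter G \<in> {x \<in> I01. u x \<in> V b} \<and> generic G \<and> u (real_of_filter G) \<notin> finite_codes"
    using forces_ex[OF q(1) forces_conj[OF q(3) forces_conj[OF forces_generic avoid[OF q(1)]]]] .
  have p'G: "p' \<in> G" using filt_down[OF G(1,2) p'(1) q(2)] .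
  have bI: "p' (b, []) = Some Infin" using p'(4) p_Infin by simp
  obtain f where f: "branch (tree_of G) b f" using generic_branch[OF G(1) _ p'G bI] G(3) by blast
  obtain Y where Y: "u (real_of_filter G) = cval (1/3) Y" "codes (tree_of G) Y" "infinite {s. Y s}"
    using generic_section[OF G(1) _ f u[OF real_of_filter_I01]] G(3) by blast
  obtain l g where l: "Y [l]" "embeds (tree_of G) (fst (entry l)) g" by (rule codes_infinite[OF Y(2,3)])
  obtain j where j: "Y [j]" "fst (entry j) = b" using G(3) Y(1) V(2)[of Y b] by auto
  \<comment> \<open>The chain has one member of length 1, so the embedding has side \<open>b\<close>
    and carries a branch of tree \<open>b\<close> into the well-founded tree.\<close>
  have "[j] = [l]" using Y(2) j(1) l(1) unfolding codes_def by (metis length_Cons)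
  then have "branch (tree_of G) (\<not> b) (g \<circ> f)" using branch_embeds l(2) j(2) f by auto
  then show False using generic_no_branch[OF G(1) _ p'G p'(3)] G(3) by blast
qed

end

theorem theorem1:
  "\<exists>B :: (real \<times> real) set.
     B \<subseteq> I01 \<times> I01 \<and> closed B \<and>
     (\<forall>x\<in>I01. uncountable {y \<in> I01. (x, y) \<in> B}) \<and>
     \<not> (\<exists>\<alpha> \<U>.
          countable_ordinal \<alpha> \<and> Field \<alpha> \<noteq> {} \<and> uncountable \<U> \<and> pairwise disjnt \<U> \<and>
          (\<forall>U\<in>\<U>. borel_uniformization B U \<and>
             borel_rank_le (top_of_set I01) (top_of_set I01) (graph_fun U) \<alpha>))"
proof (intro exI[of _ code_set] conjI code_set_subset closed_code_set ballI uncountable_sections notI)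
  assume "\<exists>\<alpha> \<U>.
          countable_ordinal \<alpha> \<and> Field \<alpha> \<noteq> {} \<and> uncountable \<U> \<and> pairwise disjnt \<U> \<and>
          (\<forall>U\<in>\<U>. borel_uniformization code_set U \<and>
             borel_rank_le (top_of_set I01) (top_of_set I01) (graph_fun U) \<alpha>)"
  then obtain \<alpha> \<U> where \<alpha>: "countable_ordinal \<alpha>" and unc: "uncountable \<U>"
    and disj: "pairwise disjnt \<U>"
    and all: "\<forall>U\<in>\<U>. borel_uniformization code_set U \<and>
      borel_rank_le (top_of_set I01) (top_of_set I01) (graph_fun U) \<alpha>"
    by (elim exE conjE) rule
  have unif: "borel_uniformization code_set U"
    and rank: "borel_rank_le (top_of_set I01) (top_of_set I01) (graph_fun U) \<alpha>" if "U \<in> \<U>" for U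
    using all that by auto
  have "Well_order \<alpha>" using \<alpha> unfolding countable_ordinal_def .
  then interpret tagged_trees \<alpha> by (rule tagged_trees.intro)
  have graph: "(x, graph_fun U x) \<in> U" if "U \<in> \<U>" "x \<in> I01" for U x
  proof -
    have "\<exists>!y. (x, y) \<in> U" using unif[OF that(1)] that(2) unfolding borel_uniformization_def by simp
    then show ?thesis unfolding graph_fun_def by (rule theI')
  qed
  have "\<exists>pd. fst pd \<in> conds \<alpha> \<and> snd pd \<in> finite_codes \<and>
      forces (fst pd) (\<lambda>G. graph_fun U (real_of_filter G) = snd pd)" if "U \<in> \<U>" for U
  proof -
    have "(x, graph_fun U x) \<in> code_set" if "x \<in> I01" for x
      using graph[OF \<open>U \<in> \<U>\<close> that] unif[OF \<open>U \<in> \<U>\<close>] unfolding borel_uniformization_def by blast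
    then obtain p d where "p \<in> conds \<alpha>" "d \<in> finite_codes"
      "forces p (\<lambda>G. graph_fun U (real_of_filter G) = d)"
      using forces_finite_code[OF _ rank[OF \<open>U \<in> \<U>\<close>]] by blast
    then show ?thesis by (intro exI[of _ "(p, d)"]) simp
  qed
  then obtain h where h: "\<And>U. U \<in> \<U> \<Longrightarrow> fst (h U) \<in> conds \<alpha> \<and> snd (h U) \<in> finite_codes \<and>
      forces (fst (h U)) (\<lambda>G. graph_fun U (real_of_filter G) = snd (h U))"
    by metis
  have "h ` \<U> \<subseteq> conds \<alpha> \<times> finite_codes"
    using h by (intro image_subsetI) (simp add: mem_Times_iff)
  then have "countable (h ` \<U>)"
    using countable_SIGMA[OF countable_conds countable_finite_codes] countable_subset by blast
  \<comment> \<open>Pigeonhole: there are uncountably many uniformizations but countably many pairs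
    of a condition and a value.\<close>
  then have "\<not> inj_on h \<U>" using unc countable_image_inj_on by blast
  then obtain U U' where U: "U \<in> \<U>" "U' \<in> \<U>" "U \<noteq> U'" "h U = h U'" unfolding inj_on_def by blast
  have p: "fst (h U) \<in> conds \<alpha>" using h U by blast
  have f: "forces (fst (h U)) (\<lambda>G. graph_fun U (real_of_filter G) = snd (h U))" using h U by blast
  have f': "forces (fst (h U)) (\<lambda>G. graph_fun U' (real_of_filter G) = snd (h U))"
    using h[OF U(2)] U(4) by simp
  \<comment> \<open>One filter meets the dense sets of both forcing statements and gives a point
    where the two functions agree.\<close>
  obtain G where "graph_fun U (real_of_filter G) = snd (h U) \<and> graph_fun U' (real_of_filter G) = snd (h U)"
    using forces_ex[OF p forces_conj[OF f f']] by blast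
  then have "(real_of_filter G, snd (h U)) \<in> U \<inter> U'"
    using graph[OF U(1) real_of_filter_I01[of G]] graph[OF U(2) real_of_filter_I01[of G]] by simp
  then show False using disj U(1-3) unfolding pairwise_def disjnt_def by blast
qed

end
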